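(* Let $[p_L,p_U]$ and $[C_L,C_U]$ be compact intervals of positive real numbers with $p_L>2$, let $\delta>0$, and let $\{a_k : k\in\mathbb{Z}\}\subset\mathbb{R}$ be a $\delta$-separated set. Let $\mathbf{g}=\{g_k\in W(L^\infty,\ell^1) : k\in\mathbb{Z}\}$ be a set of windows such that (i) for some positive constants $A_0,B_0$, $$0<A_0\le \sum_{k\in\mathbb{Z}}|g_k(t)|^2\le B_0<\infty\quad\text{for a.e. } t\in\mathbb{R};$$ (ii) for all $k\in\mathbb{Z}$, $$|g_k(t)|\le C_k(1+|t-a_k|)^{-p_k},$$ where $p_k\in[p_L,p_U]$ and $C_k\in[C_L,C_U]$. Then there exists a sequence $\{b_k^0\}_{k\in\mathbb{Z}}$ of positive real numbers with $\inf_k b_k^0>0$ such that, for every sequence $\mathbf{b}=\{b_k\}_{k\in\mathbb{Z}}$ that is contained in some compact interval $[b_L,b_U]$ of positive real numbers and satisfies $b_k\le b_k^0$ for all $k\in\mathbb{Z}$, the nonstationary Gabor system $\mathcal{G}(\mathbf{g},\mathbf{b})$ is a frame for $L^2(\mathbb{R})$.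
   Context: For $b,x\in\mathbb{R}$ let $M_b g(t)=e^{2\pi i b t}g(t)$ (modulation) and $T_x g(t)=g(t-x)$ (translation). Given windows $\mathbf{g}=\{g_k\in L^2(\mathbb{R}):k\in\mathbb{Z}\}$ and positive frequency-shift parameters $\mathbf{b}=\{b_k:k\in\mathbb{Z}\}$, put $g_{k,l}=M_{b_k l}g_k$; the nonstationary Gabor system is $\mathcal{G}(\mathbf{g},\mathbf{b})=\{g_{k,l}:k,l\in\mathbb{Z}\}$. It is a frame for $L^2(\mathbb{R})$ if there are constants $0<A\le B<\infty$ with $A\|f\|_2^2\le\sum_{k,l\in\mathbb{Z}}|\langle f,g_{k,l}\rangle|^2\le B\|f\|_2^2$ for all $f\in L^2(\mathbb{R})$. The Wiener space $W(L^\infty,\ell^1)$ is the set of $g\in L^\infty(\mathbb{R})$ with $\|g\|_{W(L^\infty,\ell^1)}:=\sum_{k\in\mathbb{Z}}\operatorname{ess\,sup}_{t\in[0,1]}|g(t+k)|<\infty$. A set $\{a_k:k\in\mathbb{Z}\}\subset\mathbb{R}$ is $\delta$-separated if $|a_k-a_m|>\delta$ whenever $k\ne m$. Pointwise inequalities between elements of $L^\infty$ are understood almost everywhere. *)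

theory Defs
  imports "HOL-Analysis.Analysis" "HOL-Probability.Essential_Supremum"
begin

text \<open>
  Elements of the Lebesgue spaces over the real line are represented by Lebesgue measurable
  functions; functions that agree almost everywhere are not identified, and no definition
  below depends on the choice of a representative.
\<close>

definition L2 :: "(real \<Rightarrow> complex) set" where
  "L2 = {f \<in> borel_measurable lebesgue. integrable lebesgue (\<lambda>t. (cmod (f t))\<^sup>2)}"

definition L2_norm :: "(real \<Rightarrow> complex) \<Rightarrow> real" where
  "L2_norm f = sqrt (LINT t|lebesgue. (cmod (f t))\<^sup>2)"

definition L2_inner :: "(real \<Rightarrow> complex) \<Rightarrow> (real \<Rightarrow> complex) \<Rightarrow> complex" where
  "L2_inner f g = (LINT t|lebesgue. f t * cnj (g t))"

definition Linf :: "(real \<Rightarrow> complex) set" where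
  "Linf = {g \<in> borel_measurable lebesgue. esssup lebesgue (\<lambda>t. ennreal (cmod (g t))) < \<infinity>}"

definition wiener_norm :: "(real \<Rightarrow> complex) \<Rightarrow> ennreal" where
  "wiener_norm g =
     (\<Sum>\<^sub>\<infinity>k\<in>(UNIV :: int set).
        esssup (lebesgue_on {0..1}) (\<lambda>t. ennreal (cmod (g (t + of_int k)))))"

definition wiener_space :: "(real \<Rightarrow> complex) set" where
  "wiener_space = {g \<in> Linf. wiener_norm g < \<infinity>}"

definition modulation :: "real \<Rightarrow> (real \<Rightarrow> complex) \<Rightarrow> real \<Rightarrow> complex" where
  "modulation b g = (\<lambda>t. exp (2 * of_real pi * \<i> * of_real b * of_real t) * g t)"

definition nonstationary_gabor_system ::
    "(int \<Rightarrow> real \<Rightarrow> complex) \<Rightarrow> (int \<Rightarrow> real) \<Rightarrow> int \<times> int \<Rightarrow> real \<Rightarrow> complex" where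
  "nonstationary_gabor_system g b = (\<lambda>(k, l). modulation (b k * of_int l) (g k))"

text \<open>
  The sum of the squared frame coefficients is taken in the extended nonnegative reals, where
  it always exists; the upper bound forces it to be finite. Membership in \<open>L2\<close> ensures that
  the coefficients are given by genuine (convergent) integrals.
\<close>

definition L2_frame :: "('i \<Rightarrow> real \<Rightarrow> complex) \<Rightarrow> bool" where
  "L2_frame \<phi> \<longleftrightarrow>
     (\<forall>i. \<phi> i \<in> L2) \<and>
     (\<exists>A B. 0 < A \<and> A \<le> B \<and>
        (\<forall>f\<in>L2.
           ennreal (A * (L2_norm f)\<^sup>2) \<le> (\<Sum>\<^sub>\<infinity>i\<in>UNIV. ennreal ((cmod (L2_inner f (\<phi> i)))\<^sup>2)) \<and>
           (\<Sum>\<^sub>\<infinity>i\<in>UNIV. ennreal ((cmod (L2_inner f (\<phi> i)))\<^sup>2)) \<le> ennreal (B * (L2_norm f)\<^sup>2)))"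

definition separated :: "real \<Rightarrow> (int \<Rightarrow> real) \<Rightarrow> bool" where
  "separated \<delta> a \<longleftrightarrow> (\<forall>k m. k \<noteq> m \<longrightarrow> \<bar>a k - a m\<bar> > \<delta>)"

end

theory Submission
  imports Defs
begin

text \<open>
  For a window \<open>g k\<close> the frame coefficients of \<open>f\<close> are the Fourier coefficients of the
  \<open>1 / b k\<close>-periodization of \<open>f * cnj (g k)\<close>, so Parseval's identity on a period (obtained from the
  Stone--Weierstrass theorem on the circle) expresses the sum of their squares as the diagonal term
  \<open>(1 / b k) * \<integral>|f|\<^sup>2 |g k|\<^sup>2\<close> plus correlations of \<open>f * cnj (g k)\<close> with its
  translates by \<open>m / b k\<close>, \<open>m \<noteq> 0\<close>.

  Put \<open>s = p\<^sub>L / 2 > 1\<close> and let all \<open>b k\<close> be at most \<open>\<beta> \<le> 1\<close>. The decay of the windows and the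
  separation of the points \<open>a k\<close> bound the sum of all off-diagonal terms by \<open>K * \<parallel>f\<parallel>\<^sup>2\<close> with
  \<open>K\<close> independent of \<open>b\<close>, since \<open>(1 / b) * (|m| / b) powr - s \<le> |m| powr - s\<close>. The diagonal terms
  sum to at least \<open>(A\<^sub>0 / \<beta>) * \<parallel>f\<parallel>\<^sup>2\<close>, so the constant sequence with
  \<open>\<beta> = min 1 (A\<^sub>0 / (K + 1))\<close> gives the lower frame bound \<open>1\<close>.
\<close>

section \<open>Sums over the integers and periodization\<close>

text \<open>Coefficient sums and correlations are nonnegative and live in \<open>ennreal\<close>, as
  integrals over \<open>count_space\<close>, so that sums and integrals of them can be interchanged
  freely. The price is that nothing may be subtracted: the Walnut representation appears as two
  inequalities, row sum \<le> diagonal + error and diagonal \<le> row sum + error. Phases of the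
  correlations are discarded, since the error only has to stay bounded while the diagonal grows like
  1/\<beta>.

  The obstacle is that every off-diagonal term carries the same factor 1/b as the diagonal one, and
  infinitely many windows contribute errors. Two values of one window at distance |m|/b satisfy (1 +
  |t - a|) (1 + |t + m/b - a|) \<ge> |m|/b. The exponent \<open>p\<^sub>L\<close> = 2s is split
  accordingly: one s is spent on |m|/b, where s > 1 both absorbs 1/b and makes the sum over m
  converge; the other s keeps the error localized near the centre, so that it can be summed over k.
  This is the origin of \<open>p\<^sub>L\<close> > 2.\<close>

lemma infsum_eq_nn_integral_count_space:
  fixes f :: "'a :: countable \<Rightarrow> ennreal"
  assumes "infinite (UNIV :: 'a set)"
  shows "(\<Sum>\<^sub>\<infinity>x\<in>UNIV. f x) = (\<integral>\<^sup>+x. f x \<partial>count_space UNIV)"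
proof -
  \<comment> \<open>On an infinite countable type this enumeration is bijective, so both sides
    become one series over \<open>nat\<close>.\<close>
  define e :: "nat \<Rightarrow> 'a" where "e = from_nat_into UNIV"
  have e: "bij_betw e UNIV UNIV"
    unfolding e_def using assms by (intro bij_betw_from_nat_into) auto
  have "(\<Sum>\<^sub>\<infinity>x\<in>UNIV. f x) = (\<Sum>\<^sub>\<infinity>j\<in>UNIV. f (e j))"
    using infsum_reindex_bij_betw[OF e, of f] by simp
  also have "\<dots> = (\<Sum>j. f (e j))"
    using has_sum_imp_sums[of "\<lambda>j. f (e j)", OF has_sum_infsum[OF nonneg_summable_on_complete]]
    by (simp add: sums_iff)
  also have "\<dots> = (\<integral>\<^sup>+x. f x \<partial>count_space UNIV)"
    using nn_integral_bij_count_space[OF e, of f] by (simp add: nn_integral_count_space_nat)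
  finally show ?thesis .
qed

text \<open>Fixes the enumeration \<open>int_decode\<close> of the integers. Complex series over the
  integers are written in the same order, so they can be compared with these sums.\<close>

lemma nn_integral_count_space_int:
  fixes f :: "int \<Rightarrow> ennreal"
  shows "(\<integral>\<^sup>+n. f n \<partial>count_space UNIV) = (\<Sum>j. f (int_decode j))"
  using nn_integral_bij_count_space[OF bij_int_decode, of f] by (simp add: nn_integral_count_space_nat)

lemma sum_le_nn_integral_count_space:
  fixes f :: "'a \<Rightarrow> ennreal"
  assumes "finite A"
  shows "(\<Sum>x\<in>A. f x) \<le> (\<integral>\<^sup>+x. f x \<partial>count_space UNIV)"
proof -
  have "(\<Sum>x\<in>A. f x) = (\<integral>\<^sup>+x. f x * indicator A x \<partial>count_space UNIV)"
    using assms by (simp add: nn_integral_count_space_indicator[symmetric] nn_integral_count_space_finite)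
  also have "\<dots> \<le> (\<integral>\<^sup>+x. f x \<partial>count_space UNIV)"
    by (intro nn_integral_mono) (auto simp: indicator_def)
  finally show ?thesis .
qed

lemma nn_integral_count_space_int_le:
  fixes f :: "int \<Rightarrow> ennreal"
  assumes "\<And>A. finite A \<Longrightarrow> (\<Sum>x\<in>A. f x) \<le> B"
  shows "(\<integral>\<^sup>+n. f n \<partial>count_space UNIV) \<le> B"
  unfolding nn_integral_count_space_int
proof (rule suminf_le_const)
  fix N
  have "(\<Sum>j<N. f (int_decode j)) = (\<Sum>n\<in>int_decode ` {..<N}. f n)"
    by (subst sum.reindex) (auto simp: inj_on_def int_decode_eq)
  also have "\<dots> \<le> B" by (rule assms) simp
  finally show "(\<Sum>j<N. f (int_decode j)) \<le> B" .
qed simp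

lemma nn_integral_count_space_shift:
  fixes f :: "int \<Rightarrow> ennreal"
  shows "(\<integral>\<^sup>+n. f (n + m) \<partial>count_space UNIV) = (\<integral>\<^sup>+n. f n \<partial>count_space UNIV)"
proof -
  have "bij (\<lambda>n::int. n + m)"
    by (rule bij_betw_byWitness[where f'="\<lambda>n. n - m"]) auto
  then show ?thesis by (rule nn_integral_bij_count_space)
qed

lemma nn_integral_count_space_swap:
  fixes f :: "'a :: countable \<Rightarrow> 'b :: countable \<Rightarrow> ennreal"
  shows "(\<integral>\<^sup>+x. \<integral>\<^sup>+y. f x y \<partial>count_space UNIV \<partial>count_space UNIV)
       = (\<integral>\<^sup>+y. \<integral>\<^sup>+x. f x y \<partial>count_space UNIV \<partial>count_space UNIV)"
  by (intro nn_integral_count_space_nn_integral) auto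

section \<open>Translation and periodization of Lebesgue integrals\<close>

lemma measurable_lebesgue_affine:
  fixes c d :: real
  assumes "f \<in> borel_measurable lebesgue" "c \<noteq> 0"
  shows "(\<lambda>t. f (d + c * t)) \<in> borel_measurable lebesgue"
proof -
  have "(\<lambda>x. d + c * x) \<in> lebesgue \<rightarrow>\<^sub>M lebesgue"
    using lebesgue_affine_measurable[where c= "\<lambda>x::real. c"] \<open>c \<noteq> 0\<close> by simp
  from measurable_compose[OF this assms(1)] show ?thesis .
qed

lemma measurable_lebesgue_translate:
  fixes d :: real
  assumes "f \<in> borel_measurable lebesgue"
  shows "(\<lambda>t. f (t + d)) \<in> borel_measurable lebesgue"
  using measurable_lebesgue_affine[OF assms, of 1 d] by (simp add: add.commute)

lemma nn_integral_lebesgue_translate: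
  fixes d :: real
  assumes "f \<in> borel_measurable lebesgue"
  shows "(\<integral>\<^sup>+t. f (t + d) \<partial>lebesgue) = (\<integral>\<^sup>+t. f t \<partial>lebesgue)"
  using nn_integral_real_affine_lebesgue[OF assms, of 1 d] by (simp add: add.commute)

lemma atLeastLessThan_lebesgue [measurable]: "{a..<b::real} \<in> sets lebesgue"
  by (intro sets_completionI_sets) simp

lemma indicator_unit_shift:
  "indicator {of_int n..<of_int n + 1} (t::real) = (indicator {n} \<lfloor>t\<rfloor> :: 'a :: zero_neq_one)"
  by (auto simp: indicator_def floor_eq_iff)

text \<open>The line is cut into the cells [n, n + 1), each of which is translated back to [0, 1).
  The cells are half-open so that every point lies in exactly one of them, namely the one with n =
  \<lfloor>t\<rfloor>.\<close>

lemma nn_integral_periodize: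
  fixes F :: "real \<Rightarrow> ennreal"
  assumes [measurable]: "F \<in> borel_measurable lebesgue"
  shows "(\<integral>\<^sup>+t. F t \<partial>lebesgue)
       = (\<integral>\<^sup>+t. \<integral>\<^sup>+n. F (t + of_int n) \<partial>count_space UNIV \<partial>lebesgue_on {0..<1})"
proof -
  have one: "(\<integral>\<^sup>+n. indicator {n} k \<partial>count_space UNIV) = 1" for k :: int
    by (subst nn_integral_count_space'[of "{k}"]) (auto simp: indicator_def)
  note [measurable] = measurable_lebesgue_translate
  have "(\<integral>\<^sup>+t. F t \<partial>lebesgue)
      = (\<integral>\<^sup>+t. \<integral>\<^sup>+n. F t * indicator {of_int n..<of_int n + 1} t \<partial>count_space UNIV \<partial>lebesgue)"
    by (rule nn_integral_cong) (simp add: indicator_unit_shift nn_integral_cmult one)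
  also have "\<dots> = (\<integral>\<^sup>+n. \<integral>\<^sup>+t. F t * indicator {of_int n..<of_int n + 1} t \<partial>lebesgue \<partial>count_space UNIV)"
    by (intro nn_integral_count_space_nn_integral) auto
  also have "\<dots> = (\<integral>\<^sup>+n. \<integral>\<^sup>+t. F (t + of_int n) * indicator {0..<1} t \<partial>lebesgue \<partial>count_space UNIV)"
  proof (rule nn_integral_cong)
    fix n :: int
    have "(\<integral>\<^sup>+t. F t * indicator {of_int n..<of_int n + 1} t \<partial>lebesgue)
        = (\<integral>\<^sup>+t. F (t + of_int n) * indicator {of_int n..<of_int n + 1} (t + of_int n) \<partial>lebesgue)"
      by (subst nn_integral_lebesgue_translate) auto
    also have "\<dots> = (\<integral>\<^sup>+t. F (t + of_int n) * indicator {0..<1} t \<partial>lebesgue)"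
      by (intro nn_integral_cong) (auto simp: indicator_def)
    finally show "(\<integral>\<^sup>+t. F t * indicator {of_int n..<of_int n + 1} t \<partial>lebesgue) = \<dots>" .
  qed
  also have "\<dots> = (\<integral>\<^sup>+n. \<integral>\<^sup>+t. F (t + of_int n) \<partial>lebesgue_on {0..<1} \<partial>count_space UNIV)"
    by (simp add: nn_integral_restrict_space)
  also have "\<dots> = (\<integral>\<^sup>+t. \<integral>\<^sup>+n. F (t + of_int n) \<partial>count_space UNIV \<partial>lebesgue_on {0..<1})"
    by (intro nn_integral_count_space_nn_integral[symmetric] countableI_type
        measurable_restrict_space1 measurable_lebesgue_translate assms)
  finally show ?thesis .
qed

section \<open>Squared modulus of a sum versus autocorrelations\<close>

lemma summable_int_decode:
  fixes x :: "int \<Rightarrow> 'a :: banach"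
  assumes "(\<integral>\<^sup>+n. ennreal (norm (x n)) \<partial>count_space UNIV) < \<infinity>"
  shows "summable (\<lambda>j. norm (x (int_decode j)))"
  using assms unfolding nn_integral_count_space_int
  by (intro summable_suminf_not_top) auto

text \<open>The double sums below are the autocorrelation of a sequence, summed over all lags.\<close>

lemma norm_suminf_power2_le:
  fixes x :: "int \<Rightarrow> complex"
  assumes "(\<integral>\<^sup>+n. ennreal (cmod (x n)) \<partial>count_space UNIV) < \<infinity>"
  shows "ennreal ((cmod (\<Sum>j. x (int_decode j)))\<^sup>2)
    \<le> (\<integral>\<^sup>+m. \<integral>\<^sup>+n. ennreal (cmod (x n) * cmod (x (n + m))) \<partial>count_space UNIV \<partial>count_space UNIV)"
proof -
  let ?c = "count_space (UNIV :: int set)"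
  note s = summable_int_decode[OF assms]
  have "ennreal (cmod (\<Sum>j. x (int_decode j))) \<le> ennreal (\<Sum>j. cmod (x (int_decode j)))"
    by (intro ennreal_leI summable_norm s)
  also have "\<dots> = (\<integral>\<^sup>+n. ennreal (cmod (x n)) \<partial>?c)"
    unfolding nn_integral_count_space_int by (intro suminf_ennreal2[symmetric] s) auto
  finally have le: "ennreal (cmod (\<Sum>j. x (int_decode j))) \<le> (\<integral>\<^sup>+n. ennreal (cmod (x n)) \<partial>?c)" .
  have "ennreal ((cmod (\<Sum>j. x (int_decode j)))\<^sup>2) = (ennreal (cmod (\<Sum>j. x (int_decode j))))\<^sup>2"
    by (simp add: ennreal_power)
  also have "\<dots> \<le> (\<integral>\<^sup>+n. ennreal (cmod (x n)) \<partial>?c)\<^sup>2"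
    using le by (intro power_mono) auto
  \<comment> \<open>The full sum is invariant under shifts of the index, so the second factor may be
    indexed by the lag measured from n.\<close>
  also have "\<dots> = (\<integral>\<^sup>+n. ennreal (cmod (x n)) * (\<integral>\<^sup>+m. ennreal (cmod (x (m + n))) \<partial>?c) \<partial>?c)"
    by (subst nn_integral_count_space_shift[where f="\<lambda>n. ennreal (cmod (x n))"])
      (simp add: power2_eq_square nn_integral_multc)
  also have "\<dots> = (\<integral>\<^sup>+n. \<integral>\<^sup>+m. ennreal (cmod (x n) * cmod (x (n + m))) \<partial>?c \<partial>?c)"
    by (simp add: nn_integral_cmult ennreal_mult add.commute)
  finally show ?thesis by (subst nn_integral_count_space_swap)
qed

text \<open>Expanding the squared modulus of the sum gives the diagonal plus products of distinct
  terms. Moving the latter to the other side in absolute value yields the estimate, with an error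
  made of nonzero lags only.\<close>

lemma nn_integral_power2_le_norm_suminf:
  fixes x :: "int \<Rightarrow> complex"
  assumes "(\<integral>\<^sup>+n. ennreal (cmod (x n)) \<partial>count_space UNIV) < \<infinity>"
  shows "(\<integral>\<^sup>+n. ennreal ((cmod (x n))\<^sup>2) \<partial>count_space UNIV) \<le> ennreal ((cmod (\<Sum>j. x (int_decode j)))\<^sup>2)
    + (\<integral>\<^sup>+m. \<integral>\<^sup>+n. ennreal (cmod (x n) * cmod (x (n + m))) \<partial>count_space UNIV \<partial>count_space (- {0}))"
    (is "_ \<le> _ + ?R")
proof -
  let ?c = "count_space (UNIV :: int set)"
  note s = summable_int_decode[OF assms]
  define z where "z j = x (int_decode j)" for j
  \<comment> \<open>Lags m \<noteq> 0 are re-indexed as ordered pairs of distinct indices, the form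
    in which the expansion of a square produces them.\<close>
  have R: "?R = (\<integral>\<^sup>+(n,m). ennreal (cmod (x n) * cmod (x m)) * indicator {(n,m). n \<noteq> m} (n,m) \<partial>count_space UNIV)"
  proof -
    have "?R = (\<integral>\<^sup>+m. \<integral>\<^sup>+n. ennreal (cmod (x n) * cmod (x (n + m))) * indicator (-{0}) m \<partial>?c \<partial>?c)"
      by (simp add: nn_integral_count_space_indicator nn_integral_multc)
    also have "\<dots> = (\<integral>\<^sup>+n. \<integral>\<^sup>+m. ennreal (cmod (x n) * cmod (x (n + m))) * indicator (-{0}) m \<partial>?c \<partial>?c)"
      by (rule nn_integral_count_space_swap)
    also have "\<dots> = (\<integral>\<^sup>+n. \<integral>\<^sup>+m. ennreal (cmod (x n) * cmod (x m)) * indicator {(n,m). n \<noteq> m} (n,m) \<partial>?c \<partial>?c)"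
    proof (rule nn_integral_cong)
      fix n :: int
      have "(\<integral>\<^sup>+m. ennreal (cmod (x n) * cmod (x m)) * indicator {(n,m). n \<noteq> m} (n,m) \<partial>?c)
        = (\<integral>\<^sup>+m. ennreal (cmod (x n) * cmod (x (m + n))) * indicator {(n,m). n \<noteq> m} (n,m + n) \<partial>?c)"
        by (rule nn_integral_count_space_shift[symmetric])
      then show "(\<integral>\<^sup>+m. ennreal (cmod (x n) * cmod (x (n + m))) * indicator (-{0}) m \<partial>?c)
        = (\<integral>\<^sup>+m. ennreal (cmod (x n) * cmod (x m)) * indicator {(n,m). n \<noteq> m} (n,m) \<partial>?c)"
        by (auto simp: add.commute indicator_def intro!: nn_integral_cong)
    qed
    finally show ?thesis by (simp add: nn_integral_fst_count_space[symmetric])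
  qed
  \<comment> \<open>The square is expanded for finite partial sums only. The error \<open>?R\<close>
    does not depend on N, so absolute summability suffices for the passage to the limit.\<close>
  have fin: "(\<Sum>j<N. ennreal ((cmod (z j))\<^sup>2)) \<le> ennreal ((cmod (\<Sum>j<N. z j))\<^sup>2) + ?R" for N
  proof -
    define D where "D = {(i,j). i < N \<and> j < N \<and> i \<noteq> j}"
    have finD: "finite D" unfolding D_def by (rule finite_subset[of _ "{..<N} \<times> {..<N}"]) auto
    have prodD: "{..<N} \<times> {..<N} = D \<union> (\<lambda>i. (i,i)) ` {..<N}" by (auto simp: D_def)
    have "complex_of_real ((cmod (\<Sum>j<N. z j))\<^sup>2) = (\<Sum>(i,j)\<in>{..<N} \<times> {..<N}. z i * cnj (z j))"
      by (simp only: complex_norm_square cnj_sum sum_product sum.cartesian_product)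
    also have "\<dots> = (\<Sum>(i,j)\<in>D. z i * cnj (z j)) + (\<Sum>i<N. z i * cnj (z i))"
      unfolding prodD using finD[unfolded D_def]
      by (subst sum.union_disjoint) (auto simp: D_def sum.reindex inj_on_def)
    also have "(\<Sum>i<N. z i * cnj (z i)) = complex_of_real (\<Sum>i<N. (cmod (z i))\<^sup>2)"
      by (simp only: of_real_sum complex_norm_square)
    finally have "complex_of_real (\<Sum>i<N. (cmod (z i))\<^sup>2)
        = complex_of_real ((cmod (\<Sum>j<N. z j))\<^sup>2) - (\<Sum>(i,j)\<in>D. z i * cnj (z j))" by simp
    then have "cmod (complex_of_real (\<Sum>i<N. (cmod (z i))\<^sup>2))
        \<le> cmod (complex_of_real ((cmod (\<Sum>j<N. z j))\<^sup>2)) + cmod (\<Sum>(i,j)\<in>D. z i * cnj (z j))"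
      by (simp only: norm_triangle_ineq4)
    also have "cmod (\<Sum>(i,j)\<in>D. z i * cnj (z j)) \<le> (\<Sum>(i,j)\<in>D. cmod (z i) * cmod (z j))"
      by (rule order_trans[OF norm_sum]) (auto simp: norm_mult intro!: sum_mono)
    finally have "(\<Sum>i<N. (cmod (z i))\<^sup>2) \<le> (cmod (\<Sum>j<N. z j))\<^sup>2 + (\<Sum>(i,j)\<in>D. cmod (z i) * cmod (z j))"
      by (simp only: norm_of_real) (simp add: sum_nonneg)
    then have "ennreal (\<Sum>i<N. (cmod (z i))\<^sup>2)
       \<le> ennreal ((cmod (\<Sum>j<N. z j))\<^sup>2) + ennreal (\<Sum>(i,j)\<in>D. cmod (z i) * cmod (z j))"
      by (subst ennreal_plus[symmetric]) (auto intro!: ennreal_leI sum_nonneg)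
    also have "ennreal (\<Sum>(i,j)\<in>D. cmod (z i) * cmod (z j)) \<le> ?R"
    proof -
      define E where "E = map_prod int_decode int_decode ` D"
      have inj: "inj_on (map_prod int_decode int_decode) D"
        using inj_on_subset[OF prod.inj_map[OF inj_int_decode inj_int_decode]] by blast
      have finE: "finite E" unfolding E_def using finD by simp
      have "ennreal (\<Sum>(i,j)\<in>D. cmod (z i) * cmod (z j)) = (\<Sum>(n,m)\<in>E. ennreal (cmod (x n) * cmod (x m)))"
        unfolding E_def by (subst sum.reindex[OF inj])
          (auto simp: z_def case_prod_unfold sum_ennreal intro!: sum.cong)
      also have "\<dots> = (\<Sum>(n,m)\<in>E. ennreal (cmod (x n) * cmod (x m)) * indicator {(n,m). n \<noteq> m} (n,m))"
        by (intro sum.cong) (auto simp: E_def D_def int_decode_eq)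
      also have "\<dots> \<le> ?R"
        unfolding R by (rule sum_le_nn_integral_count_space) (rule finE)
      finally show ?thesis .
    qed
    finally show ?thesis by (simp add: sum_ennreal add_left_mono)
  qed
  have "(\<lambda>N. (\<Sum>j<N. ennreal ((cmod (z j))\<^sup>2))) \<longlonglongrightarrow> (\<Sum>j. ennreal ((cmod (z j))\<^sup>2))"
    by (intro summable_LIMSEQ) auto
  moreover have "(\<lambda>N. ennreal ((cmod (\<Sum>j<N. z j))\<^sup>2) + ?R) \<longlonglongrightarrow> ennreal ((cmod (\<Sum>j. z j))\<^sup>2) + ?R"
    using summable_LIMSEQ[OF summable_norm_cancel[OF s]]
    by (intro tendsto_intros tendsto_ennrealI) (auto simp: z_def)
  ultimately have "(\<Sum>j. ennreal ((cmod (z j))\<^sup>2)) \<le> ennreal ((cmod (\<Sum>j. z j))\<^sup>2) + ?R"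
    by (rule LIMSEQ_le) (use fin in auto)
  then show ?thesis by (simp add: nn_integral_count_space_int z_def)
qed

section \<open>Trigonometric polynomials\<close>

definition fourier_mode :: "int \<Rightarrow> real \<Rightarrow> complex" where
  "fourier_mode l t = cis (2 * pi * of_int l * t)"

lemma fourier_mode_0 [simp]: "fourier_mode 0 t = 1"
  by (simp add: fourier_mode_def)

lemma fourier_mode_add: "fourier_mode (k + l) t = fourier_mode k t * fourier_mode l t"
  by (simp add: fourier_mode_def cis_mult algebra_simps)

lemma cnj_fourier_mode: "cnj (fourier_mode l t) = fourier_mode (- l) t"
  by (simp add: fourier_mode_def cis_cnj)

lemma norm_fourier_mode [simp]: "cmod (fourier_mode l t) = 1"
  by (simp add: fourier_mode_def)

lemma fourier_mode_periodic [simp]: "fourier_mode l (t + of_int n) = fourier_mode l t"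
proof -
  have "fourier_mode l (t + of_int n) = fourier_mode l t * cis (2 * pi * of_int (l * n))"
    by (simp add: fourier_mode_def cis_mult algebra_simps)
  also have "cis (2 * pi * of_int (l * n)) = 1"
    by (rule cis_multiple_2pi) simp
  finally show ?thesis by simp
qed

lemma continuous_on_fourier_mode: "continuous_on S (fourier_mode l)"
  unfolding fourier_mode_def by (intro continuous_intros)

lemma borel_measurable_lebesgue_continuous:
  fixes f :: "real \<Rightarrow> complex"
  assumes "continuous_on UNIV f"
  shows "f \<in> borel_measurable lebesgue"
  using borel_measurable_continuous_onI[OF assms] by (intro measurable_completion) simp

lemma fourier_mode_measurable [measurable]: "fourier_mode l \<in> borel_measurable lebesgue"
  by (intro borel_measurable_lebesgue_continuous continuous_on_fourier_mode)

lemma emeasure_unit_interval [simp]: "emeasure (lebesgue_on {0..<1::real}) {0..<1} = 1"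
  by (simp add: emeasure_restrict_space)

lemma finite_measure_unit_interval: "finite_measure (lebesgue_on {0..<1::real})"
  by (rule finite_measureI) simp

lemma integrable_unit_interval_bounded:
  fixes f :: "real \<Rightarrow> complex"
  assumes "f \<in> borel_measurable (lebesgue_on {0..<1})" "\<And>t. cmod (f t) \<le> M"
  shows "integrable (lebesgue_on {0..<1}) f"
proof -
  interpret finite_measure "lebesgue_on {0..<1::real}" by (rule finite_measure_unit_interval)
  show ?thesis using assms by (intro integrable_const_bound[of _ M]) auto
qed

text \<open>Amounts to orthonormality of the modes, because a mode times the conjugate of another is
  the mode of the difference.\<close>

lemma integral_fourier_mode:
  "(LINT t|lebesgue_on {0..<1}. fourier_mode l t) = (if l = 0 then 1 else 0)"
proof (cases "l = 0")
  case True
  then show ?thesis by (simp add: measure_restrict_space)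
next
  case False
  define w where "w = 2 * pi * real_of_int l"
  have w: "w \<noteq> 0" using False by (simp add: w_def)
  have "((\<lambda>t. cis (w * t)) has_integral (cis (w * 1) / (\<i> * w) - cis (w * 0) / (\<i> * w))) {0..1::real}"
  proof (rule fundamental_theorem_of_calculus)
    fix t :: real assume "t \<in> {0..1}"
    have "((\<lambda>z. exp (\<i> * w * z) / (\<i> * w)) has_field_derivative exp (\<i> * w * of_real t)) (at (of_real t))"
      using w by (auto intro!: derivative_eq_intros)
    from has_vector_derivative_real_field[OF this]
    show "((\<lambda>t. cis (w * t) / (\<i> * w)) has_vector_derivative cis (w * t)) (at t within {0..1})"
      by (simp add: cis_conv_exp mult.assoc)
  qed simp
  moreover have "cis (w * 1) = 1"
    using cis_multiple_2pi[of "of_int l"] by (simp add: w_def)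
  ultimately have 1: "(fourier_mode l has_integral 0) {0..1}"
    by (simp add: fourier_mode_def[abs_def] w_def)
  have "(fourier_mode l has_integral 0) {0..<1}"
    by (rule iffD1[OF has_integral_spike_set_eq 1]; rule negligible_subset[of "{1}"]) auto
  moreover have "integrable (lebesgue_on {0..<1}) (fourier_mode l)"
    by (rule integrable_unit_interval_bounded[of _ 1]) (auto intro!: measurable_restrict_space1)
  ultimately show ?thesis
    using False by (simp add: lebesgue_integral_eq_integral integral_unique)
qed

text \<open>The inductive form makes closure under products a rule induction;
  \<open>trig_poly_sum\<close> recovers the coefficients when they are needed.\<close>

inductive trig_poly :: "(real \<Rightarrow> complex) \<Rightarrow> bool" where
  mode: "trig_poly (\<lambda>t. c * fourier_mode l t)"
| add: "trig_poly f \<Longrightarrow> trig_poly g \<Longrightarrow> trig_poly (\<lambda>t. f t + g t)"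

lemma trig_poly_const: "trig_poly (\<lambda>t. c)"
  using trig_poly.mode[of c 0] by simp

lemma trig_poly_mult_mode:
  assumes "trig_poly f"
  shows "trig_poly (\<lambda>t. c * fourier_mode l t * f t)"
  using assms
proof induction
  case (mode d k)
  then show ?case
    using trig_poly.mode[of "c * d" "l + k"] by (simp add: fourier_mode_add mult_ac)
next
  case (add f g)
  then show ?case
    using trig_poly.add by (fastforce simp: distrib_left)
qed

lemma trig_poly_mult:
  assumes "trig_poly f" "trig_poly g"
  shows "trig_poly (\<lambda>t. f t * g t)"
  using assms(1)
proof induction
  case (mode c l)
  then show ?case by (rule trig_poly_mult_mode[OF assms(2)])
next
  case (add f h)
  then show ?case
    using trig_poly.add by (fastforce simp: distrib_right)
qed

lemma trig_poly_sum:
  assumes "trig_poly f"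
  shows "\<exists>L d. finite L \<and> f = (\<lambda>t. \<Sum>l\<in>L. d l * fourier_mode l t)"
  using assms
proof induction
  case (mode c l)
  show ?case by (intro exI[of _ "{l}"] exI[of _ "\<lambda>_. c"]) simp
next
  case (add f g)
  then obtain L d M e where *: "finite L" "f = (\<lambda>t. \<Sum>l\<in>L. d l * fourier_mode l t)"
    "finite M" "g = (\<lambda>t. \<Sum>l\<in>M. e l * fourier_mode l t)" by blast
  have "f t + g t = (\<Sum>l\<in>L \<union> M. ((if l \<in> L then d l else 0) + (if l \<in> M then e l else 0)) * fourier_mode l t)" for t
  proof -
    have "f t = (\<Sum>l\<in>L \<union> M. (if l \<in> L then d l else 0) * fourier_mode l t)"
      unfolding *(2) using *(1,3) by (intro sum.mono_neutral_cong_left) auto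
    moreover have "g t = (\<Sum>l\<in>L \<union> M. (if l \<in> M then e l else 0) * fourier_mode l t)"
      unfolding *(4) using *(1,3) by (intro sum.mono_neutral_cong_left) auto
    ultimately show ?thesis by (simp add: sum.distrib distrib_right)
  qed
  with * show ?case by (intro exI[of _ "L \<union> M"] exI) auto
qed

lemma trig_poly_measurable:
  assumes "trig_poly f"
  shows "f \<in> borel_measurable lebesgue"
  using assms by induction (auto intro!: borel_measurable_times borel_measurable_add)

lemma trig_poly_real_polynomial_function:
  assumes "real_polynomial_function p"
  shows "trig_poly (\<lambda>t. complex_of_real (p (cis (2 * pi * t))))"
  using assms
proof induction
  case (linear f)
  have f: "f z = Re z * f 1 + Im z * f \<i>" for z
  proof -
    have "z = Re z *\<^sub>R 1 + Im z *\<^sub>R \<i>" by (simp add: complex_eq_iff)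
    then have "f z = f (Re z *\<^sub>R 1 + Im z *\<^sub>R \<i>)" by simp
    also have "\<dots> = Re z * f 1 + Im z * f \<i>"
      using linear by (simp add: linear_add linear_scale bounded_linear.linear)
    finally show ?thesis .
  qed
  \<comment> \<open>A real-linear functional on the plane has the form z \<mapsto> 2 Re (c z) = c z
    + cnj c * cnj z. On the unit circle z and cnj z are the modes 1 and -1.\<close>
  define c where "c = Complex (f 1 / 2) (- f \<i> / 2)"
  have "complex_of_real (f (cis (2 * pi * t))) = c * fourier_mode 1 t + cnj c * fourier_mode (-1) t" for t
    by (subst f) (simp add: complex_eq_iff c_def fourier_mode_def)
  then show ?case by (simp add: trig_poly.intros)
next
  case (const c)
  show ?case by (rule trig_poly_const)
next
  case (add f g)
  then show ?case using trig_poly.add by fastforce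
next
  case (mult f g)
  then show ?case using trig_poly_mult by fastforce
qed

section \<open>Density of trigonometric polynomials, from the circle to L2 of a period\<close>

lemma trig_poly_dense_circle:
  fixes H :: "complex \<Rightarrow> complex"
  assumes "continuous_on (sphere 0 1) H" "e > 0"
  shows "\<exists>T. trig_poly T \<and> (\<forall>t. cmod (H (cis (2 * pi * t)) - T t) < e)"
proof -
  \<comment> \<open>Working on the circle instead of an interval builds the periodicity into the
    approximation, and polynomials in Re z and Im z are trigonometric polynomials there.\<close>
  obtain p where p: "polynomial_function p" "\<And>x. x \<in> sphere 0 1 \<Longrightarrow> cmod (H x - p x) < e"
    using Stone_Weierstrass_polynomial_function[OF compact_sphere assms] by blast
  have "real_polynomial_function (Re \<circ> p)" "real_polynomial_function (Im \<circ> p)"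
    using p(1) bounded_linear_Re bounded_linear_Im unfolding polynomial_function_def by auto
  then have "trig_poly (\<lambda>t. complex_of_real (Re (p (cis (2 * pi * t)))))"
    "trig_poly (\<lambda>t. complex_of_real (Im (p (cis (2 * pi * t)))))"
    by (auto dest: trig_poly_real_polynomial_function)
  then have "trig_poly (\<lambda>t. complex_of_real (Re (p (cis (2 * pi * t)))) + \<i> * complex_of_real (Im (p (cis (2 * pi * t)))))"
    by (intro trig_poly.add trig_poly_mult trig_poly_const)
  then have "trig_poly (\<lambda>t. p (cis (2 * pi * t)))"
    by (simp flip: complex_eq)
  with p(2) show ?thesis by (intro exI conjI) auto
qed

text \<open>This is the L2-closure of the trigonometric polynomials on one period. The squared
  distance is used, which avoids roots in \<open>ennreal\<close>; measurability is included so that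
  the integral of a sum of squared distances can be split.\<close>

definition trig_approx :: "(real \<Rightarrow> complex) \<Rightarrow> bool" where
  "trig_approx P \<longleftrightarrow> P \<in> borel_measurable (lebesgue_on {0..<1}) \<and>
     (\<forall>e>0. \<exists>T. trig_poly T \<and> (\<integral>\<^sup>+t. ennreal ((cmod (P t - T t))\<^sup>2) \<partial>lebesgue_on {0..<1}) < ennreal e)"

text \<open>A closure is closed; the triangle inequality for squared distances costs a factor
  2.\<close>

lemma trig_approx_closed:
  assumes P: "P \<in> borel_measurable (lebesgue_on {0..<1})"
    and Q: "\<And>e::real. e > 0 \<Longrightarrow> \<exists>Q. trig_approx Q \<and>
        (\<integral>\<^sup>+t. ennreal ((cmod (P t - Q t))\<^sup>2) \<partial>lebesgue_on {0..<1}) < ennreal e"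
  shows "trig_approx P"
  unfolding trig_approx_def
proof (intro conjI allI impI P)
  fix e :: real assume e: "e > 0"
  let ?U = "lebesgue_on {0..<1::real}"
  \<comment> \<open>Two errors of e/4, each doubled by the inequality below, add up to e.\<close>
  obtain Q where Q: "trig_approx Q" "(\<integral>\<^sup>+t. ennreal ((cmod (P t - Q t))\<^sup>2) \<partial>?U) < ennreal (e/4)"
    using Q[of "e/4"] e by auto
  then obtain T where T: "trig_poly T" "(\<integral>\<^sup>+t. ennreal ((cmod (Q t - T t))\<^sup>2) \<partial>?U) < ennreal (e/4)"
    unfolding trig_approx_def using e by (metis divide_pos_pos zero_less_numeral)
  have [measurable]: "P \<in> borel_measurable ?U" "Q \<in> borel_measurable ?U" "T \<in> borel_measurable ?U"
    using P Q T unfolding trig_approx_def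
    by (auto intro!: measurable_restrict_space1 trig_poly_measurable)
  have ineq: "(cmod (x - z))\<^sup>2 \<le> 2 * (cmod (x - y))\<^sup>2 + 2 * (cmod (y - z))\<^sup>2" for x y z
  proof -
    have "(cmod (x - z))\<^sup>2 \<le> (cmod (x - y) + cmod (y - z))\<^sup>2"
      by (intro power_mono) (use norm_triangle_ineq[of "x - y" "y - z"] in auto)
    also have "\<dots> \<le> 2 * (cmod (x - y))\<^sup>2 + 2 * (cmod (y - z))\<^sup>2"
      using sum_squares_ge_zero[of "cmod (x - y) - cmod (y - z)" 0]
      by (simp add: power2_eq_square algebra_simps)
    finally show ?thesis .
  qed
  have "(\<integral>\<^sup>+t. ennreal ((cmod (P t - T t))\<^sup>2) \<partial>?U)
      \<le> (\<integral>\<^sup>+t. 2 * ennreal ((cmod (P t - Q t))\<^sup>2) + 2 * ennreal ((cmod (Q t - T t))\<^sup>2) \<partial>?U)"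
  proof (intro nn_integral_mono)
    fix t
    have "ennreal ((cmod (P t - T t))\<^sup>2) \<le> ennreal (2 * (cmod (P t - Q t))\<^sup>2 + 2 * (cmod (Q t - T t))\<^sup>2)"
      by (intro ennreal_leI ineq)
    then show "ennreal ((cmod (P t - T t))\<^sup>2) \<le> 2 * ennreal ((cmod (P t - Q t))\<^sup>2) + 2 * ennreal ((cmod (Q t - T t))\<^sup>2)"
      by (simp add: ennreal_plus ennreal_mult)
  qed
  also have "\<dots> = 2 * (\<integral>\<^sup>+t. ennreal ((cmod (P t - Q t))\<^sup>2) \<partial>?U) + 2 * (\<integral>\<^sup>+t. ennreal ((cmod (Q t - T t))\<^sup>2) \<partial>?U)"
    by (simp add: nn_integral_add nn_integral_cmult)
  also have "\<dots> < 2 * ennreal (e/4) + 2 * ennreal (e/4)"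
    using Q(2) T(2) by (intro add_strict_mono ennreal_mult_strict_left_mono) auto
  also have "\<dots> = ennreal (2 * (e/4) + 2 * (e/4))"
    using e unfolding ennreal_numeral[symmetric]
    by (simp add: ennreal_mult[symmetric] ennreal_plus[symmetric] del: ennreal_plus ennreal_numeral)
  also have "\<dots> = ennreal e" by simp
  finally show "\<exists>T. trig_poly T \<and> (\<integral>\<^sup>+t. ennreal ((cmod (P t - T t))\<^sup>2) \<partial>?U) < ennreal e"
    using T(1) by blast
qed

text \<open>Dominated convergence as a tool for enlarging the closure. It is used to climb from
  functions continuous on the circle to functions continuous on the line, then to bounded measurable
  and finally to square-integrable ones.\<close>

lemma trig_approx_limit:
  assumes P: "P \<in> borel_measurable (lebesgue_on {0..<1})"
    and Q: "\<And>n::nat. trig_approx (Q n)"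
    and lim: "AE t in lebesgue_on {0..<1}. (\<lambda>n. Q n t) \<longlonglongrightarrow> P t"
    and bound: "\<And>n. AE t in lebesgue_on {0..<1}. (cmod (P t - Q n t))\<^sup>2 \<le> w t"
    and w: "w \<in> borel_measurable (lebesgue_on {0..<1})"
      "(\<integral>\<^sup>+t. ennreal (w t) \<partial>lebesgue_on {0..<1}) < \<infinity>"
  shows "trig_approx P"
proof (rule trig_approx_closed[OF P])
  let ?U = "lebesgue_on {0..<1::real}"
  have [measurable]: "P \<in> borel_measurable ?U" "\<And>n. Q n \<in> borel_measurable ?U" "w \<in> borel_measurable ?U"
    using P Q w(1) unfolding trig_approx_def by auto
  have "(\<lambda>n. \<integral>\<^sup>+t. ennreal ((cmod (P t - Q n t))\<^sup>2) \<partial>?U) \<longlonglongrightarrow> (\<integral>\<^sup>+t. 0 \<partial>?U)"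
  proof (rule nn_integral_dominated_convergence[where w="\<lambda>t. ennreal (w t)"])
    show "AE t in ?U. (\<lambda>n. ennreal ((cmod (P t - Q n t))\<^sup>2)) \<longlonglongrightarrow> 0"
      using lim
    proof eventually_elim
      case (elim t)
      have "(\<lambda>n. (cmod (P t - Q n t))\<^sup>2) \<longlonglongrightarrow> (cmod (P t - P t))\<^sup>2"
        using elim by (intro tendsto_intros)
      from tendsto_ennrealI[OF this] show ?case by simp
    qed
    show "AE t in ?U. ennreal ((cmod (P t - Q n t))\<^sup>2) \<le> ennreal (w t)" for n
      using bound[of n] by eventually_elim (rule ennreal_leI)
  qed (use w in auto)
  then have lim0: "(\<lambda>n. \<integral>\<^sup>+t. ennreal ((cmod (P t - Q n t))\<^sup>2) \<partial>?U) \<longlonglongrightarrow> 0" by simp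
  fix e :: real assume "e > 0"
  then have "eventually (\<lambda>n. (\<integral>\<^sup>+t. ennreal ((cmod (P t - Q n t))\<^sup>2) \<partial>?U) < ennreal e) sequentially"
    by (intro order_tendstoD(2)[OF lim0]) simp
  then show "\<exists>Q. trig_approx Q \<and> (\<integral>\<^sup>+t. ennreal ((cmod (P t - Q t))\<^sup>2) \<partial>?U) < ennreal e"
    using Q by (meson eventually_happens trivial_limit_sequentially)
qed

lemma Arg2pi_cis:
  assumes "0 \<le> t" "t < 1"
  shows "Arg2pi (cis (2 * pi * t)) = 2 * pi * t"
  using assms by (intro Arg2pi_unique[of 1]) (auto simp: cis_conv_exp)

text \<open>The factor \<open>min 1 (n * cmod (z - 1))\<close> removes the jump of \<open>Arg2pi\<close> at \<open>1\<close>.\<close>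

lemma trig_approx_continuous:
  assumes h: "continuous_on UNIV h" and M: "\<And>t. cmod (h t) \<le> M"
  shows "trig_approx h"
proof -
  let ?U = "lebesgue_on {0..<1::real}"
  have M0: "0 \<le> M" using M[of 0] norm_ge_zero order_trans by blast
  define H :: "nat \<Rightarrow> complex \<Rightarrow> complex" where
    "H n z = of_real (min 1 (real n * cmod (z - 1))) * h (Arg2pi z / (2 * pi))" for n z
  \<comment> \<open>\<open>Arg2pi\<close> is continuous off the nonnegative real axis, which meets
    the circle only in 1.\<close>
  have nonReal: "z \<notin> \<real>\<^sub>\<ge>\<^sub>0" if "z \<in> sphere 0 1" "z \<noteq> 1" for z :: complex
    using that by (auto simp: complex_nonneg_Reals_iff cmod_def complex_eq_iff power2_eq_1_iff)
  have contH: "continuous_on (sphere 0 1) (H n)" for n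
  proof (rule continuous_at_imp_continuous_on, rule ballI)
    fix z :: complex assume z: "z \<in> sphere 0 1"
    show "isCont (H n) z"
    proof (cases "z = 1")
      case True
      have "((\<lambda>z. H n z) \<longlongrightarrow> 0) (at 1)"
      \<comment> \<open>At 1 the damping factor, at most n |z - 1|, outweighs the bounded but
        possibly discontinuous second factor.\<close>
      proof (rule Lim_null_comparison)
        show "eventually (\<lambda>z. cmod (H n z) \<le> real n * cmod (z - 1) * M) (at 1)"
          using M M0 by (intro always_eventually allI)
            (auto simp: H_def norm_mult intro!: mult_mono)
        have "((\<lambda>z::complex. real n * cmod (z - 1) * M) \<longlongrightarrow> real n * cmod (1 - 1) * M) (at 1)"
          by (intro tendsto_intros)
        then show "((\<lambda>z::complex. real n * cmod (z - 1) * M) \<longlongrightarrow> 0) (at 1)" by simp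
      qed
      moreover have "H n 1 = 0" by (simp add: H_def)
      ultimately show ?thesis by (simp add: True isCont_def)
    next
      case False
      have "isCont Arg2pi z" by (intro continuous_at_Arg2pi nonReal z False)
      then have "isCont (\<lambda>z. Arg2pi z / (2 * pi)) z"
        by (rule continuous_divide) (rule continuous_const, simp)
      moreover have "isCont h (Arg2pi z / (2 * pi))"
        using h by (simp add: continuous_on_eq_continuous_at)
      ultimately have "isCont (\<lambda>z. h (Arg2pi z / (2 * pi))) z"
        by (rule isCont_o2)
      then show ?thesis unfolding H_def by (intro continuous_intros)
    qed
  qed
  define Q where "Q n t = H n (cis (2 * pi * t))" for n t
  have Qeq: "Q n t = of_real (min 1 (real n * cmod (cis (2 * pi * t) - 1))) * h t" if "0 \<le> t" "t < 1" for n t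
    by (simp add: Q_def H_def Arg2pi_cis that)
  have measQ: "Q n \<in> borel_measurable lebesgue" for n
    unfolding Q_def
    by (intro borel_measurable_lebesgue_continuous continuous_on_compose2[OF contH] continuous_intros) auto
  have measH: "h \<in> borel_measurable lebesgue"
    by (rule borel_measurable_lebesgue_continuous[OF h])
  show ?thesis
  proof (rule trig_approx_limit[where Q=Q and w="\<lambda>_. M\<^sup>2"])
    show "h \<in> borel_measurable ?U" by (intro measurable_restrict_space1 measH)
    show "trig_approx (Q n)" for n
      unfolding trig_approx_def
    proof (intro conjI allI impI measurable_restrict_space1 measQ)
      fix e :: real assume e: "e > 0"
      obtain T where T: "trig_poly T" "\<And>t. cmod (H n (cis (2 * pi * t)) - T t) < sqrt (e/2)"
        using trig_poly_dense_circle[OF contH[of n], of "sqrt (e/2)"] e by auto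
      have "(\<integral>\<^sup>+t. ennreal ((cmod (Q n t - T t))\<^sup>2) \<partial>?U) \<le> (\<integral>\<^sup>+t. ennreal (e/2) \<partial>?U)"
      proof (intro nn_integral_mono ennreal_leI)
        fix t
        have "(cmod (Q n t - T t))\<^sup>2 \<le> (sqrt (e/2))\<^sup>2"
          using T(2)[of t] by (intro power_mono) (auto simp: Q_def)
        then show "(cmod (Q n t - T t))\<^sup>2 \<le> e/2" using e by simp
      qed
      also have "\<dots> = ennreal (e/2)" by simp
      also have "\<dots> < ennreal e" using e by (intro ennreal_lessI) auto
      finally show "\<exists>T. trig_poly T \<and> (\<integral>\<^sup>+t. ennreal ((cmod (Q n t - T t))\<^sup>2) \<partial>?U) < ennreal e"
        using T(1) by blast
    qed
    \<comment> \<open>At t = 0 every \<open>Q n\<close> vanishes, so convergence to \<open>h\<close>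
      may fail there. At every other point of the period the damping factor is eventually 1.\<close>
    have "AE t in lebesgue. t \<noteq> (0::real)"
      by (rule AE_completion) (rule AE_lborel_singleton)
    then have "AE t in ?U. t \<noteq> 0"
      by (subst AE_restrict_space_iff) auto
    then show "AE t in ?U. (\<lambda>n. Q n t) \<longlonglongrightarrow> h t"
      using AE_space
    proof eventually_elim
      case (elim t)
      then have t: "0 < t" "t < 1" by auto
      have "cis (2 * pi * t) \<noteq> 1"
        using Arg2pi_cis[of t] t Arg2pi_of_real[of 1] by auto
      then have pos: "cmod (cis (2 * pi * t) - 1) > 0" by simp
      obtain N :: nat where N: "1 / cmod (cis (2 * pi * t) - 1) \<le> real N" using real_arch_simple by blast
      have "eventually (\<lambda>n. Q n t = h t) sequentially"
        using eventually_ge_at_top[of N]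
      proof eventually_elim
        case (elim n)
        have "1 / cmod (cis (2 * pi * t) - 1) \<le> real n" using N elim by linarith
        then have "1 \<le> real n * cmod (cis (2 * pi * t) - 1)" using pos by (simp add: divide_le_eq)
        then show ?case using t by (simp add: Qeq min_absorb1)
      qed
      then show ?case by (rule tendsto_eventually)
    qed
    show "AE t in ?U. (cmod (h t - Q n t))\<^sup>2 \<le> M\<^sup>2" for n
    proof (rule AE_I2)
      fix t assume "t \<in> space ?U"
      then have t: "0 \<le> t" "t < 1" by auto
      define c where "c = min 1 (real n * cmod (cis (2 * pi * t) - 1))"
      have c: "0 \<le> c" "c \<le> 1" by (auto simp: c_def)
      have "Q n t = of_real c * h t" unfolding c_def by (rule Qeq[OF t])
      then have "h t - Q n t = of_real (1 - c) * h t" by (simp add: algebra_simps)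
      then have "cmod (h t - Q n t) = (1 - c) * cmod (h t)"
        using c by (simp add: norm_mult del: of_real_diff)
      also have "\<dots> \<le> 1 * M" using c M M0 by (intro mult_mono) auto
      finally show "(cmod (h t - Q n t))\<^sup>2 \<le> M\<^sup>2" by (intro power_mono) auto
    qed
  qed (auto simp: ennreal_less_top)
qed

text \<open>The radial retraction of the plane onto the closed disc of radius M. Dividing by the
  maximum keeps the denominator positive, so for M > 0 a single continuous formula covers both
  cases.\<close>

definition radial_clamp :: "real \<Rightarrow> complex \<Rightarrow> complex" where
  "radial_clamp M z = of_real (M / max M (cmod z)) * z"

lemma continuous_radial_clamp: "0 < M \<Longrightarrow> continuous_on S (radial_clamp M)"
  unfolding radial_clamp_def by (intro continuous_intros) auto

lemma norm_radial_clamp: "0 < M \<Longrightarrow> cmod (radial_clamp M z) \<le> M"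
  by (auto simp: radial_clamp_def norm_mult norm_divide max_def field_simps)

lemma radial_clamp_eq: "0 < M \<Longrightarrow> cmod z \<le> M \<Longrightarrow> radial_clamp M z = z"
  by (simp add: radial_clamp_def max_absorb1)

lemma norm_diff_radial_clamp: 
  assumes "0 < M"
  shows "cmod (z - radial_clamp M z) \<le> cmod z"
proof -
  define c where "c = M / max M (cmod z)"
  have c: "0 \<le> c" "c \<le> 1" using assms by (auto simp: c_def)
  have "radial_clamp M z = of_real c * z" unfolding radial_clamp_def c_def by (rule refl)
  then have "z - radial_clamp M z = of_real (1 - c) * z" by (simp add: algebra_simps)
  then have "cmod (z - radial_clamp M z) = (1 - c) * cmod z"
    using c by (simp add: norm_mult del: of_real_diff)
  then show ?thesis using c by (simp add: mult_left_le_one_le)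
qed

lemma measurable_radial_clamp:
  assumes "0 < M" "f \<in> borel_measurable N"
  shows "(\<lambda>t. radial_clamp M (f t)) \<in> borel_measurable N"
  by (rule measurable_compose[OF assms(2)])
     (intro borel_measurable_continuous_onI continuous_radial_clamp assms)

text \<open>A measurable function is an a.e. limit of continuous ones. These may be unbounded, but
  clamping them preserves continuity and convergence and supplies the constant dominating
  function.\<close>

lemma trig_approx_clamp:
  assumes P: "P \<in> borel_measurable lebesgue" and M: "0 < M"
  shows "trig_approx (\<lambda>t. radial_clamp M (P t))"
proof -
  have "P measurable_on UNIV"
    by (rule lebesgue_measurable_imp_measurable_on[OF P]) simp
  then obtain N g where N: "negligible N" and g: "\<And>n::nat. continuous_on UNIV (g n)"
    and lim: "\<And>x. x \<notin> N \<Longrightarrow> (\<lambda>n. g n x) \<longlonglongrightarrow> P x"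
    unfolding measurable_on_def by auto
  show ?thesis
  proof (rule trig_approx_limit[where Q="\<lambda>n t. radial_clamp M (g n t)" and w="\<lambda>_. (2 * M)\<^sup>2"])
    show "trig_approx (\<lambda>t. radial_clamp M (g n t))" for n
      by (intro trig_approx_continuous[of _ M] norm_radial_clamp M
          continuous_on_compose2[OF continuous_radial_clamp[OF M] g]) auto
    have "AE t in lebesgue. t \<notin> N"
      using N by (simp add: negligible_iff_null_sets AE_not_in)
    then have "AE t in lebesgue_on {0..<1}. t \<notin> N"
      by (subst AE_restrict_space_iff) auto
    then show "AE t in lebesgue_on {0..<1}. (\<lambda>n. radial_clamp M (g n t)) \<longlonglongrightarrow> radial_clamp M (P t)"
    proof eventually_elim
      case (elim t)
      show ?case
        by (rule continuous_on_tendsto_compose[OF continuous_radial_clamp[OF M, of UNIV] lim[OF elim]]) auto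
    qed
    show "AE t in lebesgue_on {0..<1}. (cmod (radial_clamp M (P t) - radial_clamp M (g n t)))\<^sup>2 \<le> (2 * M)\<^sup>2" for n
    proof (intro AE_I2 power_mono)
      fix t
      have "cmod (radial_clamp M (P t) - radial_clamp M (g n t))
          \<le> cmod (radial_clamp M (P t)) + cmod (radial_clamp M (g n t))" by (rule norm_triangle_ineq4)
      also have "\<dots> \<le> M + M" by (intro add_mono norm_radial_clamp M)
      finally show "cmod (radial_clamp M (P t) - radial_clamp M (g n t)) \<le> 2 * M" by simp
    qed simp
  qed (auto simp: ennreal_less_top intro!: measurable_restrict_space1 measurable_radial_clamp P M)
qed

text \<open>Truncation at growing levels is eventually exact at each point, and clamping moves a
  value by at most its own modulus, so the squared modulus of \<open>P\<close> dominates. Levels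
  \<open>Suc n\<close> are positive, as clamping requires.\<close>

lemma trig_approx_L2:
  assumes P: "P \<in> borel_measurable lebesgue"
    and fin: "(\<integral>\<^sup>+t. ennreal ((cmod (P t))\<^sup>2) \<partial>lebesgue_on {0..<1}) < \<infinity>"
  shows "trig_approx P"
proof (rule trig_approx_limit[where Q="\<lambda>n t. radial_clamp (real (Suc n)) (P t)" and w="\<lambda>t. (cmod (P t))\<^sup>2"])
  have [measurable]: "P \<in> borel_measurable (lebesgue_on {0..<1})"
    by (intro measurable_restrict_space1 P)
  show "P \<in> borel_measurable (lebesgue_on {0..<1})" "(\<lambda>t. (cmod (P t))\<^sup>2) \<in> borel_measurable (lebesgue_on {0..<1})"
    by measurable
  show "AE t in lebesgue_on {0..<1}. (\<lambda>n. radial_clamp (real (Suc n)) (P t)) \<longlonglongrightarrow> P t"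
  proof (rule AE_I2)
    fix t
    obtain N :: nat where N: "cmod (P t) \<le> real N" using real_arch_simple by blast
    have "eventually (\<lambda>n. radial_clamp (real (Suc n)) (P t) = P t) sequentially"
      using eventually_ge_at_top[of N] by eventually_elim (use N in \<open>auto intro!: radial_clamp_eq\<close>)
    then show "(\<lambda>n. radial_clamp (real (Suc n)) (P t)) \<longlonglongrightarrow> P t"
      by (rule tendsto_eventually)
  qed
  show "AE t in lebesgue_on {0..<1}. (cmod (P t - radial_clamp (real (Suc n)) (P t)))\<^sup>2 \<le> (cmod (P t))\<^sup>2" for n
    by (intro AE_I2 power_mono norm_diff_radial_clamp) auto
qed (use trig_approx_clamp[OF P] fin in auto)

section \<open>Parseval's identity\<close>

lemma borel_measurable_cnj [measurable (raw)]:
  "f \<in> borel_measurable M \<Longrightarrow> (\<lambda>t. cnj (f t)) \<in> borel_measurable M"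
  by (rule measurable_compose) (auto intro!: borel_measurable_continuous_onI continuous_intros)

definition fourier_coeff :: "(real \<Rightarrow> complex) \<Rightarrow> int \<Rightarrow> complex" where
  "fourier_coeff P l = (LINT t|lebesgue_on {0..<1}. P t * cnj (fourier_mode l t))"

text \<open>The trigonometric polynomial with the Fourier coefficients of \<open>P\<close> is the best approximation
  of \<open>P\<close> with frequencies in \<open>L\<close>.\<close>

lemma trig_poly_distance:
  fixes P :: "real \<Rightarrow> complex"
  assumes P: "P \<in> borel_measurable lebesgue"
    and fin: "(\<integral>\<^sup>+t. ennreal ((cmod (P t))\<^sup>2) \<partial>lebesgue_on {0..<1}) < \<infinity>" and L: "finite L"
  shows "(\<integral>\<^sup>+t. ennreal ((cmod (P t - (\<Sum>l\<in>L. d l * fourier_mode l t)))\<^sup>2) \<partial>lebesgue_on {0..<1})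
       + ennreal (\<Sum>l\<in>L. (cmod (fourier_coeff P l))\<^sup>2)
       = (\<integral>\<^sup>+t. ennreal ((cmod (P t))\<^sup>2) \<partial>lebesgue_on {0..<1})
       + ennreal (\<Sum>l\<in>L. (cmod (fourier_coeff P l - d l))\<^sup>2)"
proof -
  let ?U = "lebesgue_on {0..<1::real}"
  interpret U: finite_measure ?U by (rule finite_measure_unit_interval)
  have [measurable]: "P \<in> borel_measurable ?U" "\<And>l. fourier_mode l \<in> borel_measurable ?U"
    by (auto intro!: measurable_restrict_space1 P)
  define c where "c = fourier_coeff P"
  define T where "T t = (\<Sum>l\<in>L. d l * fourier_mode l t)" for t
  have [measurable]: "T \<in> borel_measurable ?U" unfolding T_def by measurable
  have int2: "integrable ?U (\<lambda>t. (cmod (P t))\<^sup>2)"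
    using fin by (intro integrableI_bounded) auto
  have intP: "integrable ?U P"
  proof (rule Bochner_Integration.integrable_bound[of _ "\<lambda>t. 1 + (cmod (P t))\<^sup>2"])
    show "AE t in ?U. cmod (P t) \<le> norm (1 + (cmod (P t))\<^sup>2)"
    proof (rule AE_I2)
      fix t
      have "0 \<le> (cmod (P t) - 1)\<^sup>2" by simp
      then have "2 * cmod (P t) \<le> 1 + (cmod (P t))\<^sup>2" unfolding power2_diff by simp
      then show "cmod (P t) \<le> norm (1 + (cmod (P t))\<^sup>2)"
        using norm_ge_zero[of "P t"] by (simp del: norm_ge_zero)
    qed
  qed (use int2 in auto)
  have intPm: "integrable ?U (\<lambda>t. P t * cnj (fourier_mode l t))" for l
    by (rule Bochner_Integration.integrable_bound[OF intP]) (auto simp: norm_mult)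
  have intmm: "integrable ?U (fourier_mode l)" for l
    by (rule integrable_unit_interval_bounded[of _ 1]) auto
  have PT: "(\<lambda>t. P t * cnj (T t)) = (\<lambda>t. \<Sum>l\<in>L. cnj (d l) * (P t * cnj (fourier_mode l t)))"
    by (simp add: T_def cnj_sum sum_distrib_left mult_ac)
  have iPT: "integrable ?U (\<lambda>t. P t * cnj (T t))"
    unfolding PT by (intro Bochner_Integration.integrable_sum integrable_mult_right intPm)
  have PT': "(LINT t|?U. P t * cnj (T t)) = (\<Sum>l\<in>L. cnj (d l) * c l)"
    unfolding PT by (simp add: intPm c_def fourier_coeff_def)
  have TT: "(\<lambda>t. T t * cnj (T t)) = (\<lambda>t. \<Sum>k\<in>L. \<Sum>l\<in>L. d k * cnj (d l) * fourier_mode (k - l) t)"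
  proof
    fix t
    have *: "fourier_mode (k - l) t = fourier_mode k t * cnj (fourier_mode l t)" for k l
      using fourier_mode_add[of k "- l" t] by (simp add: cnj_fourier_mode)
    show "T t * cnj (T t) = (\<Sum>k\<in>L. \<Sum>l\<in>L. d k * cnj (d l) * fourier_mode (k - l) t)"
      by (simp add: T_def cnj_sum sum_product * mult_ac)
  qed
  have iTT: "integrable ?U (\<lambda>t. T t * cnj (T t))"
    unfolding TT by (intro Bochner_Integration.integrable_sum integrable_mult_right intmm)
  have TT': "(LINT t|?U. T t * cnj (T t)) = (\<Sum>l\<in>L. complex_of_real ((cmod (d l))\<^sup>2))"
  proof -
    have "(LINT t|?U. T t * cnj (T t)) = (\<Sum>k\<in>L. \<Sum>l\<in>L. d k * cnj (d l) * (if k - l = 0 then 1 else 0))"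
      unfolding TT by (simp add: intmm integral_fourier_mode del: right_minus_eq)
    also have "\<dots> = (\<Sum>k\<in>L. \<Sum>l\<in>L. if k = l then d k * cnj (d l) else 0)"
      by (intro sum.cong) auto
    also have "\<dots> = (\<Sum>k\<in>L. d k * cnj (d k))" using L by (simp add: sum.delta)
    finally show ?thesis by (simp only: complex_norm_square)
  qed
  have iPP: "integrable ?U (\<lambda>t. complex_of_real ((cmod (P t))\<^sup>2))"
    using int2 by (rule integrable_of_real)
  have iTP: "integrable ?U (\<lambda>t. cnj (P t * cnj (T t)))" using iPT by (rule integrable_cnj)
  have expand: "complex_of_real ((cmod (P t - T t))\<^sup>2)
      = complex_of_real ((cmod (P t))\<^sup>2) - P t * cnj (T t) - cnj (P t * cnj (T t)) + T t * cnj (T t)" for t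
    by (simp add: complex_norm_square algebra_simps del: of_real_power)
  have int_diff: "integrable ?U (\<lambda>t. complex_of_real ((cmod (P t - T t))\<^sup>2))"
    unfolding expand by (intro Bochner_Integration.integrable_add Bochner_Integration.integrable_diff iPP iPT iTP iTT)
  then have int_diff': "integrable ?U (\<lambda>t. (cmod (P t - T t))\<^sup>2)"
    by (rule iffD1[OF complex_of_real_integrable_eq])
  have "complex_of_real (LINT t|?U. (cmod (P t - T t))\<^sup>2) = (LINT t|?U. complex_of_real ((cmod (P t - T t))\<^sup>2))"
    by (rule integral_complex_of_real[symmetric])
  also have "\<dots> = complex_of_real (LINT t|?U. (cmod (P t))\<^sup>2) - (\<Sum>l\<in>L. cnj (d l) * c l)
      - cnj (\<Sum>l\<in>L. cnj (d l) * c l) + (\<Sum>l\<in>L. complex_of_real ((cmod (d l))\<^sup>2))"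
    unfolding expand
    apply (subst Bochner_Integration.integral_add)
      apply (intro Bochner_Integration.integrable_diff iPP iPT iTP)
     apply (rule iTT)
    apply (subst Bochner_Integration.integral_diff)
      apply (intro Bochner_Integration.integrable_diff iPP iPT)
     apply (rule iTP)
    apply (subst Bochner_Integration.integral_diff)
      apply (rule iPP iPT)+
    apply (simp only: integral_complex_of_real Bochner_Integration.integral_cnj PT' TT')
    done
  also have "\<dots> = complex_of_real ((LINT t|?U. (cmod (P t))\<^sup>2) - (\<Sum>l\<in>L. (cmod (c l))\<^sup>2) + (\<Sum>l\<in>L. (cmod (c l - d l))\<^sup>2))"
  proof -
    \<comment> \<open>Completing the square in the coefficients.\<close>
    have "(\<Sum>l\<in>L. complex_of_real ((cmod (c l - d l))\<^sup>2)) = (\<Sum>l\<in>L. complex_of_real ((cmod (c l))\<^sup>2)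
       - cnj (d l) * c l - cnj (cnj (d l) * c l) + complex_of_real ((cmod (d l))\<^sup>2))"
      by (intro sum.cong refl) (simp add: complex_norm_square algebra_simps del: of_real_power)
    then show ?thesis by (simp add: sum.distrib sum_subtractf cnj_sum)
  qed
  \<comment> \<open>Both sides are sums of nonnegative terms, so the identity carries over to
    \<open>ennreal\<close> without subtraction.\<close>
  finally have eq: "(LINT t|?U. (cmod (P t - T t))\<^sup>2) + (\<Sum>l\<in>L. (cmod (c l))\<^sup>2)
      = (LINT t|?U. (cmod (P t))\<^sup>2) + (\<Sum>l\<in>L. (cmod (c l - d l))\<^sup>2)"
    unfolding of_real_eq_iff by simp
  have 1: "(\<integral>\<^sup>+t. ennreal ((cmod (P t - T t))\<^sup>2) \<partial>?U) = ennreal (LINT t|?U. (cmod (P t - T t))\<^sup>2)"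
    by (intro nn_integral_eq_integral int_diff') auto
  have 2: "(\<integral>\<^sup>+t. ennreal ((cmod (P t))\<^sup>2) \<partial>?U) = ennreal (LINT t|?U. (cmod (P t))\<^sup>2)"
    by (intro nn_integral_eq_integral int2) auto
  show ?thesis
    using eq unfolding T_def[symmetric] c_def[symmetric] 1 2
    by (subst (1 2) ennreal_plus[symmetric]) (auto intro!: sum_nonneg)
qed

text \<open>Both directions come from \<open>trig_poly_distance\<close>. Taking \<open>d\<close> to
  be the Fourier coefficients gives Bessel's inequality; taking the coefficients of a close
  trigonometric polynomial gives the converse up to e.\<close>

theorem parseval_unit_interval:
  fixes P :: "real \<Rightarrow> complex"
  assumes P: "P \<in> borel_measurable lebesgue"
    and fin: "(\<integral>\<^sup>+t. ennreal ((cmod (P t))\<^sup>2) \<partial>lebesgue_on {0..<1}) < \<infinity>"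
  shows "(\<integral>\<^sup>+l. ennreal ((cmod (fourier_coeff P l))\<^sup>2) \<partial>count_space UNIV)
       = (\<integral>\<^sup>+t. ennreal ((cmod (P t))\<^sup>2) \<partial>lebesgue_on {0..<1})" (is "?S = ?I")
proof (rule antisym)
  show "?S \<le> ?I"
  proof (rule nn_integral_count_space_int_le)
    fix L :: "int set" assume L: "finite L"
    let ?T = "\<lambda>t. \<Sum>l\<in>L. fourier_coeff P l * fourier_mode l t"
    have "ennreal (\<Sum>l\<in>L. (cmod (fourier_coeff P l))\<^sup>2)
        \<le> (\<integral>\<^sup>+t. ennreal ((cmod (P t - ?T t))\<^sup>2) \<partial>lebesgue_on {0..<1})
          + ennreal (\<Sum>l\<in>L. (cmod (fourier_coeff P l))\<^sup>2)" by simp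
    also have "\<dots> = ?I + ennreal (\<Sum>l\<in>L. (cmod (fourier_coeff P l - fourier_coeff P l))\<^sup>2)"
      by (rule trig_poly_distance[OF P fin L])
    finally have "ennreal (\<Sum>l\<in>L. (cmod (fourier_coeff P l))\<^sup>2) \<le> ?I" by simp
    then show "(\<Sum>l\<in>L. ennreal ((cmod (fourier_coeff P l))\<^sup>2)) \<le> ?I" by (simp add: sum_ennreal)
  qed
  show "?I \<le> ?S"
  proof (rule ennreal_le_epsilon)
    fix e :: real assume "e > 0"
    then obtain T where T: "trig_poly T" "(\<integral>\<^sup>+t. ennreal ((cmod (P t - T t))\<^sup>2) \<partial>lebesgue_on {0..<1}) < ennreal e"
      using trig_approx_L2[OF P fin] unfolding trig_approx_def by blast
    obtain L d where L: "finite L" "T = (\<lambda>t. \<Sum>l\<in>L. d l * fourier_mode l t)"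
      using trig_poly_sum[OF T(1)] by blast
    have "?I \<le> ?I + ennreal (\<Sum>l\<in>L. (cmod (fourier_coeff P l - d l))\<^sup>2)" by simp
    also have "\<dots> = (\<integral>\<^sup>+t. ennreal ((cmod (P t - T t))\<^sup>2) \<partial>lebesgue_on {0..<1})
        + ennreal (\<Sum>l\<in>L. (cmod (fourier_coeff P l))\<^sup>2)"
      unfolding L(2) by (rule trig_poly_distance[OF P fin L(1), symmetric])
    also have "\<dots> \<le> ennreal e + ?S"
      using T(2) sum_le_nn_integral_count_space[OF L(1), of "\<lambda>l. ennreal ((cmod (fourier_coeff P l))\<^sup>2)"]
      by (intro add_mono) (auto simp: sum_ennreal)
    finally show "?I \<le> ?S + ennreal e" by (simp add: add.commute)
  qed
qed

section \<open>The Walnut representation\<close>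

text \<open>The complex-valued counterpart of \<open>nn_integral_periodize\<close>. Series and
  integral are exchanged twice, once on the period and once on the line for the pieces
  \<open>J j\<close> of \<open>H\<close>; the nonnegative version applied to the modulus justifies
  both exchanges.\<close>

lemma integral_periodize:
  fixes H :: "real \<Rightarrow> complex"
  assumes H: "integrable lebesgue H"
  shows "(LINT t|lebesgue_on {0..<1}. (\<Sum>j. H (t + of_int (int_decode j)))) = (LINT t|lebesgue. H t)"
proof -
  let ?U = "lebesgue_on {0..<1::real}"
  let ?n = "\<lambda>j. real_of_int (int_decode j)"
  have [measurable]: "H \<in> borel_measurable lebesgue" using H by auto
  define J where "J j t = indicator {?n j..<?n j + 1} t *\<^sub>R H t" for j t
  have shiftH: "integrable lebesgue (\<lambda>t. H (t + c))" for c
    using lebesgue_integrable_real_affine[OF H, of 1 c] by (simp add: add.commute)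
  have intU: "integrable ?U (\<lambda>t. H (t + c))" for c
    using shiftH[of c] by (simp add: integrable_restrict_space integrable_mult_indicator)
  have J_shift: "J j (t + ?n j) = indicator {0..<1} t *\<^sub>R H (t + ?n j)" for j t
    by (auto simp: J_def indicator_def)
  have intJ: "integrable lebesgue (J j)" for j
    unfolding J_def by (intro integrable_mult_indicator H) auto
  have J_eq: "(LINT t|lebesgue. J j t) = (LINT t|?U. H (t + ?n j))" for j
  proof -
    have "(LINT t|lebesgue. J j t) = (LINT t|lebesgue. J j (t + ?n j))"
      using lebesgue_integral_real_affine[of 1 "J j" "?n j"] by (simp add: add.commute)
    also have "\<dots> = (LINT t|?U. H (t + ?n j))"
      unfolding J_shift by (simp add: integral_restrict_space)
    finally show ?thesis .
  qed
  have J_norm_eq: "(LINT t|lebesgue. norm (J j t)) = (LINT t|?U. norm (H (t + ?n j)))" for j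
  proof -
    have "(LINT t|lebesgue. norm (J j t)) = (LINT t|lebesgue. norm (J j (t + ?n j)))"
      using lebesgue_integral_real_affine[of 1 "\<lambda>t. norm (J j t)" "?n j"] by (simp add: add.commute)
    also have "\<dots> = (LINT t|?U. norm (H (t + ?n j)))"
      unfolding J_shift by (simp add: integral_restrict_space)
    finally show ?thesis .
  qed
  have tile: "(\<integral>\<^sup>+t. \<integral>\<^sup>+n. ennreal (norm (H (t + of_int n))) \<partial>count_space UNIV \<partial>?U) < \<infinity>"
    using H unfolding integrable_iff_bounded
    by (subst nn_integral_periodize[of "\<lambda>t. ennreal (norm (H t))", symmetric]) auto
  have [measurable]: "(\<lambda>t. H (t + c)) \<in> borel_measurable ?U" for c
    by (intro measurable_restrict_space1 measurable_lebesgue_translate) simp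
  have meas: "(\<lambda>t. \<integral>\<^sup>+n. ennreal (norm (H (t + of_int n))) \<partial>count_space UNIV) \<in> borel_measurable ?U"
    unfolding nn_integral_count_space_int by measurable
  have AE_sum: "AE t in ?U. summable (\<lambda>j. norm (H (t + ?n j)))"
    using nn_integral_PInf_AE[OF meas] tile
    by (auto elim!: eventually_mono intro!: summable_int_decode[of "\<lambda>n. H (_ + of_int n)"] simp: less_top)
  have sum_int: "summable (\<lambda>j. LINT t|?U. norm (H (t + ?n j)))"
  proof (rule summable_suminf_not_top)
    have "(\<Sum>j. ennreal (LINT t|?U. norm (H (t + ?n j)))) = (\<Sum>j. \<integral>\<^sup>+t. ennreal (norm (H (t + ?n j))) \<partial>?U)"
      by (intro arg_cong[where f=suminf] ext nn_integral_eq_integral[symmetric] integrable_norm intU) auto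
    also have "\<dots> = (\<integral>\<^sup>+t. (\<Sum>j. ennreal (norm (H (t + ?n j)))) \<partial>?U)"
      by (intro nn_integral_suminf[symmetric]) auto
    also have "\<dots> < \<infinity>" using tile by (simp add: nn_integral_count_space_int)
    finally show "(\<Sum>j. ennreal (LINT t|?U. norm (H (t + ?n j)))) \<noteq> top" by simp
  qed auto
  \<comment> \<open>At each point only one piece is nonzero, so summing the pieces raises no
    convergence question.\<close>
  have J_single: "(\<lambda>j. J j t) = (\<lambda>j. if j = int_encode \<lfloor>t\<rfloor> then H t else 0)" for t
  proof
    fix j
    have "j = int_encode \<lfloor>t\<rfloor> \<longleftrightarrow> \<lfloor>t\<rfloor> = int_decode j"
      by (metis int_decode_inverse int_encode_inverse)
    then show "J j t = (if j = int_encode \<lfloor>t\<rfloor> then H t else 0)"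
      unfolding J_def indicator_unit_shift by (auto simp: indicator_def)
  qed
  have J_sum: "(\<Sum>j. J j t) = H t" for t
    unfolding J_single using sums_single[of "int_encode \<lfloor>t\<rfloor>" "\<lambda>_. H t"] by (simp add: sums_iff)
  have "(LINT t|?U. (\<Sum>j. H (t + ?n j))) = (\<Sum>j. LINT t|?U. H (t + ?n j))"
    by (rule integral_suminf[OF intU AE_sum sum_int])
  also have "\<dots> = (\<Sum>j. LINT t|lebesgue. J j t)" by (simp add: J_eq)
  also have "\<dots> = (LINT t|lebesgue. (\<Sum>j. J j t))"
  proof (rule integral_suminf[symmetric, OF intJ])
    show "AE t in lebesgue. summable (\<lambda>j. norm (J j t))"
    proof (rule AE_I2)
      fix t :: real
      show "summable (\<lambda>j. norm (J j t))"
        by (rule summable_finite[of "{int_encode \<lfloor>t\<rfloor>}"]) (simp, simp add: J_single[THEN fun_cong])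
    qed
    show "summable (\<lambda>j. LINT t|lebesgue. norm (J j t))" using sum_int by (simp add: J_norm_eq)
  qed
  finally show ?thesis by (simp add: J_sum)
qed

text \<open>The autocorrelation inequalities are applied at each t to the sequence n \<mapsto> G (t
  + n) and integrated over a period. Its sum is the periodization \<open>P\<close>, whose squared
  norm Parseval turns into the coefficient sum.\<close>

lemma walnut_unit:
  fixes G :: "real \<Rightarrow> complex"
  defines "A \<equiv> \<lambda>m::int. \<integral>\<^sup>+t. ennreal (cmod (G t) * cmod (G (t + of_int m))) \<partial>lebesgue"
    and "c \<equiv> \<lambda>l. LINT t|lebesgue. G t * cnj (fourier_mode l t)"
  assumes G: "integrable lebesgue G" and fin: "(\<integral>\<^sup>+m. A m \<partial>count_space UNIV) < \<infinity>"
  shows "(\<integral>\<^sup>+l. ennreal ((cmod (c l))\<^sup>2) \<partial>count_space UNIV) \<le> (\<integral>\<^sup>+m. A m \<partial>count_space UNIV)" (is ?upper)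
    and "(\<integral>\<^sup>+t. ennreal ((cmod (G t))\<^sup>2) \<partial>lebesgue)
      \<le> (\<integral>\<^sup>+l. ennreal ((cmod (c l))\<^sup>2) \<partial>count_space UNIV) + (\<integral>\<^sup>+m. A m \<partial>count_space (- {0}))" (is ?L)
proof -
  let ?U = "lebesgue_on {0..<1::real}" and ?C = "count_space (UNIV :: int set)"
  have [measurable]: "G \<in> borel_measurable lebesgue" using G by auto
  have G_shift [measurable]: "(\<lambda>t. G (t + d)) \<in> borel_measurable lebesgue" for d
    by (intro measurable_lebesgue_translate) simp
  then have [measurable]: "(\<lambda>t. G (t + d)) \<in> borel_measurable ?U" for d
    by (rule measurable_restrict_space1)
  define P where "P t = (\<Sum>j. G (t + of_int (int_decode j)))" for t
  have P [measurable]: "P \<in> borel_measurable lebesgue" unfolding P_def by measurable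
  then have [measurable]: "P \<in> borel_measurable ?U" by (rule measurable_restrict_space1)
  have "(\<integral>\<^sup>+t. \<integral>\<^sup>+n. ennreal (cmod (G (t + of_int n))) \<partial>?C \<partial>?U) < \<infinity>"
    using G unfolding integrable_iff_bounded
    by (subst nn_integral_periodize[of "\<lambda>t. ennreal (cmod (G t))", symmetric]) auto
  moreover have meas: "(\<lambda>t. \<integral>\<^sup>+n. ennreal (cmod (G (t + of_int n))) \<partial>?C) \<in> borel_measurable ?U"
    unfolding nn_integral_count_space_int by measurable
  ultimately have AE_fin: "AE t in ?U. (\<integral>\<^sup>+n. ennreal (cmod (G (t + of_int n))) \<partial>?C) < \<infinity>"
    using nn_integral_PInf_AE[OF meas] by (auto elim!: eventually_mono simp: less_top)
  \<comment> \<open>The lag-m autocorrelation along the orbit of t; undoing the periodization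
    identifies its integral with \<open>A m\<close>.\<close>
  define R where "R t m = (\<integral>\<^sup>+n. ennreal (cmod (G (t + of_int n)) * cmod (G (t + of_int (n + m)))) \<partial>?C)" for t m
  have R_meas [measurable]: "(\<lambda>t. R t m) \<in> borel_measurable ?U" for m
    unfolding R_def nn_integral_count_space_int by measurable
  have R_A: "(\<integral>\<^sup>+t. R t m \<partial>?U) = A m" for m
    unfolding A_def R_def
    by (subst nn_integral_periodize) (auto simp: add_ac)
  have int_R: "(\<integral>\<^sup>+t. \<integral>\<^sup>+m. R t m \<partial>count_space M \<partial>?U) = (\<integral>\<^sup>+m. A m \<partial>count_space M)" for M :: "int set"
    by (subst nn_integral_count_space_nn_integral) (auto simp: R_A)
  have P_le: "(\<integral>\<^sup>+t. ennreal ((cmod (P t))\<^sup>2) \<partial>?U) \<le> (\<integral>\<^sup>+m. A m \<partial>?C)"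
    unfolding int_R[symmetric]
  proof (rule nn_integral_mono_AE, use AE_fin in eventually_elim)
    case (elim t)
    then show ?case
      unfolding P_def R_def by (rule norm_suminf_power2_le)
  qed
  have G_le: "(\<integral>\<^sup>+t. ennreal ((cmod (G t))\<^sup>2) \<partial>lebesgue)
      \<le> (\<integral>\<^sup>+t. ennreal ((cmod (P t))\<^sup>2) \<partial>?U) + (\<integral>\<^sup>+m. A m \<partial>count_space (- {0}))"
  proof -
    have meas': "(\<lambda>t. \<integral>\<^sup>+m. R t m \<partial>count_space (- {0})) \<in> borel_measurable ?U"
    proof -
      have eq: "(\<integral>\<^sup>+m. R t m \<partial>count_space (- {0})) = (\<integral>\<^sup>+m. R t m * indicator (- {0}) m \<partial>?C)" for t
        by (simp add: nn_integral_count_space_indicator)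
      show ?thesis unfolding eq nn_integral_count_space_int by measurable
    qed
    have "(\<integral>\<^sup>+t. ennreal ((cmod (G t))\<^sup>2) \<partial>lebesgue)
      = (\<integral>\<^sup>+t. \<integral>\<^sup>+n. ennreal ((cmod (G (t + of_int n)))\<^sup>2) \<partial>?C \<partial>?U)"
      by (rule nn_integral_periodize) measurable
    also have "\<dots> \<le> (\<integral>\<^sup>+t. ennreal ((cmod (P t))\<^sup>2) + (\<integral>\<^sup>+m. R t m \<partial>count_space (- {0})) \<partial>?U)"
    proof (rule nn_integral_mono_AE, use AE_fin in eventually_elim)
      case (elim t)
      then show ?case
        unfolding P_def R_def by (rule nn_integral_power2_le_norm_suminf)
    qed
    also have "\<dots> = (\<integral>\<^sup>+t. ennreal ((cmod (P t))\<^sup>2) \<partial>?U) + (\<integral>\<^sup>+m. A m \<partial>count_space (- {0}))"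
      unfolding int_R[symmetric] by (rule nn_integral_add[OF _ meas']) measurable
    finally show ?thesis .
  qed
  \<comment> \<open>The modes have period 1, so they can be taken inside the periodizing
    series.\<close>
  have coeff: "fourier_coeff P l = c l" for l
  proof -
    have "integrable lebesgue (\<lambda>t. G t * cnj (fourier_mode l t))"
      by (rule Bochner_Integration.integrable_bound[OF G]) (auto simp: norm_mult)
    note integral_periodize[OF this]
    moreover have "P t * cnj (fourier_mode l t)
       = (\<Sum>j. G (t + of_int (int_decode j)) * cnj (fourier_mode l (t + of_int (int_decode j))))"
      if "(\<integral>\<^sup>+n. ennreal (cmod (G (t + of_int n))) \<partial>?C) < \<infinity>" for t
      using summable_norm_cancel[OF summable_int_decode[OF that]]
      unfolding P_def by (simp add: suminf_mult2)
    then have "fourier_coeff P l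
       = (LINT t|?U. (\<Sum>j. G (t + of_int (int_decode j)) * cnj (fourier_mode l (t + of_int (int_decode j)))))"
      unfolding fourier_coeff_def using AE_fin
      by (intro integral_cong_AE) (auto elim!: eventually_mono intro!: measurable_restrict_space1[where M=lebesgue])
    ultimately show ?thesis by (simp add: c_def)
  qed
  \<comment> \<open>Square integrability of \<open>P\<close>, required by Parseval, is itself a
    consequence of \<open>P_le\<close> and finite correlations.\<close>
  have parseval: "(\<integral>\<^sup>+l. ennreal ((cmod (c l))\<^sup>2) \<partial>?C) = (\<integral>\<^sup>+t. ennreal ((cmod (P t))\<^sup>2) \<partial>?U)"
    unfolding coeff[symmetric] using P_le fin by (intro parseval_unit_interval P) auto
  show ?upper unfolding parseval by (rule P_le)
  show ?L unfolding parseval by (rule G_le)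
qed

text \<open>Dilation by q = 1/b reduces the period to 1. The substitution puts one factor q on each
  correlation but q^2 on each squared coefficient, which leaves the weight 1/b on the
  correlations.\<close>

lemma walnut:
  fixes F :: "real \<Rightarrow> complex" and b :: real
  defines "A \<equiv> \<lambda>m::int. \<integral>\<^sup>+t. ennreal (cmod (F t) * cmod (F (t + of_int m / b))) \<partial>lebesgue"
    and "c \<equiv> \<lambda>l. LINT t|lebesgue. F t * cnj (fourier_mode l (b * t))"
  assumes F: "integrable lebesgue F" and b: "0 < b" and fin: "(\<integral>\<^sup>+m. A m \<partial>count_space UNIV) < \<infinity>"
  shows "(\<integral>\<^sup>+l. ennreal ((cmod (c l))\<^sup>2) \<partial>count_space UNIV)
      \<le> ennreal (1 / b) * (\<integral>\<^sup>+m. A m \<partial>count_space UNIV)" (is ?U)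
    and "ennreal (1 / b) * (\<integral>\<^sup>+t. ennreal ((cmod (F t))\<^sup>2) \<partial>lebesgue)
      \<le> (\<integral>\<^sup>+l. ennreal ((cmod (c l))\<^sup>2) \<partial>count_space UNIV)
        + ennreal (1 / b) * (\<integral>\<^sup>+m. A m \<partial>count_space (- {0}))" (is ?L)
proof -
  define q where "q = 1 / b"
  have q: "0 < q" "q \<noteq> 0" using b by (auto simp: q_def)
  define G where "G s = F (0 + q * s)" for s
  have [measurable]: "F \<in> borel_measurable lebesgue" using F by auto
  have [measurable]: "(\<lambda>t. F (t + d)) \<in> borel_measurable lebesgue" for d
    by (intro measurable_lebesgue_translate) simp
  have G: "integrable lebesgue G"
    unfolding G_def by (rule lebesgue_integrable_real_affine[OF F]) (use q in auto)
  define A' where "A' m = (\<integral>\<^sup>+t. ennreal (cmod (G t) * cmod (G (t + of_int m))) \<partial>lebesgue)" for m :: int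
  define c' where "c' l = (LINT t|lebesgue. G t * cnj (fourier_mode l t))" for l
  have A: "A m = ennreal q * A' m" for m
  proof -
    have "A m = ennreal \<bar>q\<bar> * (\<integral>\<^sup>+s. ennreal (cmod (F (0 + q * s)) * cmod (F ((0 + q * s) + of_int m / b))) \<partial>lebesgue)"
      unfolding A_def by (rule nn_integral_real_affine_lebesgue) (use q in auto)
    then show ?thesis using q by (simp add: A'_def G_def q_def algebra_simps)
  qed
  have c: "c l = of_real q * c' l" for l
  proof -
    have "c l = \<bar>q\<bar> *\<^sub>R (LINT s|lebesgue. F (0 + q * s) * cnj (fourier_mode l (b * (0 + q * s))))"
      unfolding c_def by (rule lebesgue_integral_real_affine) (rule q)
    then show ?thesis using b by (simp add: c'_def G_def q_def scaleR_conv_of_real)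
  qed
  have N: "(\<integral>\<^sup>+t. ennreal ((cmod (F t))\<^sup>2) \<partial>lebesgue) = ennreal q * (\<integral>\<^sup>+t. ennreal ((cmod (G t))\<^sup>2) \<partial>lebesgue)"
    using nn_integral_real_affine_lebesgue[of "\<lambda>t. ennreal ((cmod (F t))\<^sup>2)" q 0] q by (simp add: G_def)
  have fin': "(\<integral>\<^sup>+m. A' m \<partial>count_space UNIV) < \<infinity>"
    using fin q by (auto simp: A nn_integral_cmult ennreal_mult_less_top)
  have sumc: "(\<integral>\<^sup>+l. ennreal ((cmod (c l))\<^sup>2) \<partial>count_space UNIV)
      = ennreal q * (ennreal q * (\<integral>\<^sup>+l. ennreal ((cmod (c' l))\<^sup>2) \<partial>count_space UNIV))"
  proof -
    have "ennreal ((cmod (c l))\<^sup>2) = ennreal q * (ennreal q * ennreal ((cmod (c' l))\<^sup>2))" for l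
      using q by (simp add: c norm_mult power_mult_distrib ennreal_mult power2_eq_square mult_ac)
    then show ?thesis by (simp add: nn_integral_cmult)
  qed
  note w = walnut_unit[OF G fin'[unfolded A'_def], folded A'_def c'_def]
  show ?U
    unfolding sumc A q_def[symmetric] using w(1)
    by (simp add: nn_integral_cmult mult_left_mono)
  have "ennreal q * (ennreal q * (\<integral>\<^sup>+t. ennreal ((cmod (G t))\<^sup>2) \<partial>lebesgue))
     \<le> ennreal q * (ennreal q * ((\<integral>\<^sup>+l. ennreal ((cmod (c' l))\<^sup>2) \<partial>count_space UNIV) + (\<integral>\<^sup>+m. A' m \<partial>count_space (- {0}))))"
    using w(2) by (intro mult_left_mono) auto
  then show ?L
    unfolding sumc A N q_def[symmetric]
    by (simp add: nn_integral_cmult distrib_left)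
qed

section \<open>Decaying windows\<close>

lemma AE_lebesgue_translate:
  fixes d :: real
  assumes "AE t in lebesgue. Q t"
  shows "AE t in lebesgue. Q (t + d)"
proof -
  obtain N where N: "N \<in> null_sets lebesgue" "{t. \<not> Q t} \<subseteq> N"
    using assms unfolding eventually_ae_filter by auto
  then have [measurable]: "N \<in> sets lebesgue" by auto
  have meas: "(\<lambda>t. indicator N (t + d) :: ennreal) \<in> borel_measurable lebesgue"
    by (rule measurable_lebesgue_translate) measurable
  have "(\<integral>\<^sup>+t. indicator N (t + d) \<partial>lebesgue) = (\<integral>\<^sup>+t. indicator N t \<partial>lebesgue)"
    by (rule nn_integral_lebesgue_translate) measurable
  also have "\<dots> = 0" using N(1) by (simp add: null_sets_def)
  finally have "AE t in lebesgue. indicator N (t + d) = (0 :: ennreal)"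
    by (subst (asm) nn_integral_0_iff_AE[OF meas])
  then show ?thesis
    using N(2) by (auto elim!: eventually_mono simp: indicator_def split: if_splits)
qed

lemma decay_measurable [measurable]:
  "(\<lambda>t::real. (1 + \<bar>t - a\<bar>) powr r) \<in> borel_measurable lebesgue"
  by (rule measurable_completion) measurable

text \<open>Half of the decay, (u v)^(-s), is at most x^(-s) b^s, and b^s \<le> b cancels the factor
  1/b. From the other half u^(-s) is kept and v^(-s) \<le> 1 is dropped. In the application u and v
  measure the distances of t and its translate to the centre, and x = |m|.\<close>

lemma decay_product_le:
  fixes u v x b s :: real
  assumes "1 \<le> u" "1 \<le> v" "0 < x" "0 < b" "b \<le> 1" "1 < s" "x / b \<le> u * v"
  shows "1 / b * (u powr (- 2 * s) * v powr (- 2 * s)) \<le> x powr (- s) * u powr (- s)"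
proof -
  have "(u * v) powr (- s) \<le> (x / b) powr (- s)"
    using assms by (intro powr_mono2') auto
  also have "\<dots> = x powr (- s) * b powr s"
    using assms by (simp add: powr_divide powr_minus field_simps)
  also have "b powr s = b * b powr (s - 1)"
    using assms by (simp add: powr_mult_base)
  also have "x powr (- s) * (b * b powr (s - 1)) \<le> x powr (- s) * (b * 1)"
    using assms by (intro mult_left_mono powr_le1) auto
  finally have 1: "(u * v) powr (- s) \<le> x powr (- s) * b" by simp
  have split: "y powr (- 2 * s) = y powr (- s) * y powr (- s)" for y :: real
    by (simp flip: powr_add)
  have "v powr (- s) \<le> v powr 0" using assms by (intro powr_mono) auto
  then have 2: "v powr (- s) \<le> 1" using assms by simp
  have "u powr (- 2 * s) * v powr (- 2 * s) = (u * v) powr (- s) * (u powr (- s) * v powr (- s))"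
    unfolding split using assms by (simp add: powr_mult mult_ac)
  also have "\<dots> \<le> (x powr (- s) * b) * (u powr (- s) * 1)"
    using assms 1 2 by (intro mult_mono) auto
  finally show ?thesis using assms by (simp add: field_simps)
qed

lemma nn_integral_count_space_inj_le:
  assumes "inj \<kappa>"
  shows "(\<integral>\<^sup>+x. f (\<kappa> x) \<partial>count_space UNIV) \<le> (\<integral>\<^sup>+y. f y \<partial>count_space UNIV)"
proof -
  have "(\<integral>\<^sup>+x. f (\<kappa> x) \<partial>count_space UNIV) = (\<integral>\<^sup>+y. f y \<partial>count_space (range \<kappa>))"
    by (rule nn_integral_bij_count_space) (use assms in \<open>simp add: bij_betw_def\<close>)
  also have "\<dots> \<le> (\<integral>\<^sup>+y. f y \<partial>count_space UNIV)"
    by (simp add: nn_integral_count_space_indicator[of "range \<kappa>"]) (auto intro!: nn_integral_mono simp: indicator_def)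
  finally show ?thesis .
qed

section \<open>Decay sums over the integers and over separated centres\<close>

definition decay_sum :: "real \<Rightarrow> ennreal" where
  "decay_sum s = (\<integral>\<^sup>+j. ennreal ((1 + \<bar>real_of_int j\<bar>) powr (- s)) \<partial>count_space UNIV)"

lemma decay_sum_finite:
  assumes "1 < s"
  shows "decay_sum s < \<infinity>"
proof -
  define h where "h n = (1 + real n) powr (- s)" for n
  have "summable (\<lambda>n. real (Suc n) powr (- s))"
    using assms by (subst summable_Suc_iff) (simp add: summable_real_powr_iff)
  then have sm: "summable h" by (simp add: h_def[abs_def])
  \<comment> \<open>The map to \<open>nat \<bar>x\<bar>\<close> is two-to-one away from 0 but
    injective on each half-line; this is applied to the two halves separately.\<close>
  have part: "(\<Sum>x\<in>A. ennreal (h (nat \<bar>x\<bar>))) \<le> (\<Sum>n. ennreal (h n))"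
    if "finite A" "inj_on (\<lambda>x. nat \<bar>x\<bar>) A" for A :: "int set"
  proof -
    have "(\<Sum>x\<in>A. ennreal (h (nat \<bar>x\<bar>))) = (\<Sum>n\<in>(\<lambda>x. nat \<bar>x\<bar>) ` A. ennreal (h n))"
      using that(2) by (simp add: sum.reindex)
    also have "\<dots> \<le> (\<Sum>n. ennreal (h n))"
      using that(1) by (intro sum_le_suminf) auto
    finally show ?thesis .
  qed
  have "decay_sum s = (\<integral>\<^sup>+j. ennreal (h (nat \<bar>j\<bar>)) \<partial>count_space UNIV)"
    unfolding decay_sum_def h_def by (intro nn_integral_cong) simp
  also have "\<dots> \<le> (\<Sum>n. ennreal (h n)) + (\<Sum>n. ennreal (h n))"
  proof (rule nn_integral_count_space_int_le)
    fix A :: "int set" assume A: "finite A"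
    have "(\<Sum>x\<in>A. ennreal (h (nat \<bar>x\<bar>)))
      = (\<Sum>x\<in>A \<inter> {0..}. ennreal (h (nat \<bar>x\<bar>))) + (\<Sum>x\<in>A - {0..}. ennreal (h (nat \<bar>x\<bar>)))"
      using A by (rule sum.Int_Diff)
    also have "\<dots> \<le> (\<Sum>n. ennreal (h n)) + (\<Sum>n. ennreal (h n))"
      using A by (intro add_mono part) (auto simp: inj_on_def)
    finally show "(\<Sum>x\<in>A. ennreal (h (nat \<bar>x\<bar>))) \<le> (\<Sum>n. ennreal (h n)) + (\<Sum>n. ennreal (h n))" .
  qed
  also have "\<dots> < \<infinity>"
  proof -
    have "(\<Sum>n. ennreal (h n)) \<noteq> top" by (rule ennreal_suminf_neq_top[OF sm]) (simp add: h_def)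
    then show ?thesis by (simp add: less_top)
  qed
  finally show ?thesis .
qed

lemma punctured_decay_sum_finite:
  assumes "1 < s"
  shows "(\<integral>\<^sup>+m. ennreal (\<bar>real_of_int m\<bar> powr (- s)) \<partial>count_space (- {0})) < \<infinity>"
proof -
  have "(\<integral>\<^sup>+m. ennreal (\<bar>real_of_int m\<bar> powr (- s)) \<partial>count_space (- {0}))
      \<le> (\<integral>\<^sup>+m. ennreal (2 powr s) * ennreal ((1 + \<bar>real_of_int m\<bar>) powr (- s)) \<partial>count_space UNIV)"
    unfolding nn_integral_count_space_indicator[of "- {0::int}", simplified]
  proof (rule nn_integral_mono)
    fix m :: int
    show "ennreal (\<bar>real_of_int m\<bar> powr (- s)) * indicator (- {0}) m
        \<le> ennreal (2 powr s) * ennreal ((1 + \<bar>real_of_int m\<bar>) powr (- s))"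
    proof (cases "m = 0")
      case False
      \<comment> \<open>Hence |m| \<ge> (1 + |m|) / 2, the source of the constant 2^s.\<close>
      then have "1 \<le> \<bar>real_of_int m\<bar>" by linarith
      then have "\<bar>of_int m\<bar> powr (- s) \<le> ((1 + \<bar>of_int m\<bar>) / 2) powr (- s)"
        using assms by (intro powr_mono2') auto
      also have "\<dots> = 2 powr s * (1 + \<bar>of_int m\<bar>) powr (- s)"
        by (simp add: powr_divide powr_minus field_simps)
      finally show ?thesis by (simp add: indicator_def ennreal_mult[symmetric] ennreal_leI)
    qed simp
  qed
  also have "\<dots> = ennreal (2 powr s) * decay_sum s"
    by (simp add: nn_integral_cmult decay_sum_def)
  also have "\<dots> < \<infinity>" using decay_sum_finite[OF assms] by (simp add: ennreal_mult_less_top)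
  finally show ?thesis .
qed

text \<open>Intervals of length \<delta> contain at most one of the centres, so numbering the cells
  around t maps the centres injectively to integers, and the decay is comparable to that of the cell
  number. The bound is uniform in t, which allows it to be integrated later.\<close>

lemma separated_decay_sum_le:
  assumes sep: "separated \<delta> a" and \<delta>: "0 < \<delta>" and s: "1 < s"
  shows "(\<integral>\<^sup>+k. ennreal ((1 + \<bar>t - a k\<bar>) powr (- s)) \<partial>count_space UNIV)
      \<le> ennreal ((min 1 \<delta> / 2) powr (- s)) * decay_sum s"
proof -
  define \<kappa> where "\<kappa> k = \<lfloor>(t - a k) / \<delta>\<rfloor>" for k
  \<comment> \<open>Chosen so that 2c \<le> \<delta> and 2c \<le> 1: the first handles distant
    cells, the second the few cells near t.\<close>
  define c where "c = min 1 \<delta> / 2"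
  have c: "0 < c" using \<delta> by (simp add: c_def)
  have floor: "of_int (\<kappa> k) * \<delta> \<le> t - a k" "t - a k < (of_int (\<kappa> k) + 1) * \<delta>" for k
    using \<delta> floor_divide_lower[of \<delta> "t - a k"] floor_divide_upper[of \<delta> "t - a k"]
    by (auto simp: \<kappa>_def)
  have inj: "inj \<kappa>"
  proof (rule injI, rule ccontr)
    fix k m assume eq: "\<kappa> k = \<kappa> m" and "k \<noteq> m"
    then have "\<bar>a k - a m\<bar> > \<delta>" using sep by (simp add: separated_def)
    moreover have "\<bar>a k - a m\<bar> < \<delta>"
      using floor[of k] floor[of m] unfolding eq by (auto simp: algebra_simps abs_less_iff)
    ultimately show False by simp
  qed
  have le: "(1 + \<bar>t - a k\<bar>) powr (- s) \<le> c powr (- s) * (1 + \<bar>of_int (\<kappa> k)\<bar>) powr (- s)" for k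
  proof -
    define j where "j = \<bar>real_of_int (\<kappa> k)\<bar>"
    have "\<bar>\<kappa> k\<bar> = 0 \<or> 1 \<le> \<bar>\<kappa> k\<bar>" by linarith
    then have j0: "j = 0 \<or> 1 \<le> j" unfolding j_def by (simp flip: of_int_abs)
    \<comment> \<open>The loss of one cell occurs for negative numbers, where the end of the cell
      nearest to 0 is the upper one.\<close>
    have "(j - 1) * \<delta> \<le> \<bar>t - a k\<bar>"
    proof (cases "\<kappa> k \<ge> 0")
      case True
      then show ?thesis using floor[of k] \<delta> by (simp add: j_def algebra_simps)
    next
      case False
      then show ?thesis using floor[of k] \<delta> by (simp add: j_def algebra_simps)
    qed
    moreover have "c * (1 + j) \<le> 1 + (j - 1) * \<delta>" if "1 \<le> j"
    proof -
      have "2 * c \<le> \<delta>" "2 * c \<le> 1" by (auto simp: c_def)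
      then have "(2 * c) * (j - 1) \<le> \<delta> * (j - 1)" using that by (intro mult_right_mono) auto
      moreover have "c * (1 + j) \<le> 1 + (2 * c) * (j - 1)"
      proof -
        have "c * j \<ge> c" using that c by simp
        then show ?thesis using \<open>2 * c \<le> 1\<close> by (simp add: algebra_simps)
      qed
      ultimately show ?thesis by (simp add: mult.commute)
    qed
    moreover have "c * (1 + j) \<le> 1" if "j = 0" using that by (simp add: c_def)
    ultimately have "c * (1 + j) \<le> 1 + \<bar>t - a k\<bar>" using j0 by fastforce
    then have "(1 + \<bar>t - a k\<bar>) powr (- s) \<le> (c * (1 + j)) powr (- s)"
      using s c j0 by (intro powr_mono2') auto
    also have "\<dots> = c powr (- s) * (1 + j) powr (- s)"
      by (rule powr_mult)
    finally show ?thesis by (simp add: j_def)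
  qed
  have "(\<integral>\<^sup>+k. ennreal ((1 + \<bar>t - a k\<bar>) powr (- s)) \<partial>count_space UNIV)
      \<le> (\<integral>\<^sup>+k. ennreal (c powr (- s)) * ennreal ((1 + \<bar>of_int (\<kappa> k)\<bar>) powr (- s)) \<partial>count_space UNIV)"
    by (intro nn_integral_mono) (simp add: ennreal_mult[symmetric] ennreal_leI le)
  also have "\<dots> = ennreal (c powr (- s)) * (\<integral>\<^sup>+k. ennreal ((1 + \<bar>of_int (\<kappa> k)\<bar>) powr (- s)) \<partial>count_space UNIV)"
    by (simp add: nn_integral_cmult)
  also have "\<dots> \<le> ennreal (c powr (- s)) * decay_sum s"
    unfolding decay_sum_def by (intro mult_left_mono nn_integral_count_space_inj_le[OF inj]) auto
  finally show ?thesis by (simp add: c_def)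
qed

text \<open>Periodization rewrites the integral as an average over one period of decay sums with
  centres a - n. Their spacing is 1 and separation is strict, hence the value 1/2.\<close>

lemma nn_integral_decay_finite:
  assumes "1 < s"
  shows "(\<integral>\<^sup>+t. ennreal ((1 + \<bar>t - a\<bar>) powr (- s)) \<partial>lebesgue) < \<infinity>"
proof -
  have sep: "separated (1/2) (\<lambda>n. a - of_int n)"
    unfolding separated_def
  proof (intro allI impI)
    fix k m :: int assume "k \<noteq> m"
    then have "1 \<le> \<bar>real_of_int (m - k)\<bar>" by linarith
    then show "1/2 < \<bar>a - real_of_int k - (a - real_of_int m)\<bar>" by simp
  qed
  have "(\<integral>\<^sup>+t. ennreal ((1 + \<bar>t - a\<bar>) powr (- s)) \<partial>lebesgue)
      = (\<integral>\<^sup>+t. \<integral>\<^sup>+n. ennreal ((1 + \<bar>t + of_int n - a\<bar>) powr (- s)) \<partial>count_space UNIV \<partial>lebesgue_on {0..<1})"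
    by (rule nn_integral_periodize) measurable
  also have "\<dots> \<le> (\<integral>\<^sup>+t. ennreal ((min 1 (1/2) / 2) powr (- s)) * decay_sum s \<partial>lebesgue_on {0..<1::real})"
    using separated_decay_sum_le[OF sep _ assms] by (intro nn_integral_mono) (simp add: algebra_simps)
  also have "\<dots> < \<infinity>" using decay_sum_finite[OF assms] by (simp add: ennreal_mult_less_top)
  finally show ?thesis .
qed

section \<open>Estimates for a single window and its modulations\<close>

lemma L2_nn_integral:
  assumes "f \<in> L2"
  shows "(\<integral>\<^sup>+t. ennreal ((cmod (f t))\<^sup>2) \<partial>lebesgue) = ennreal ((L2_norm f)\<^sup>2)"
  using assms unfolding L2_def L2_norm_def by (subst nn_integral_eq_integral) auto

lemma L2_decay:
  assumes g: "g \<in> borel_measurable lebesgue" and s: "1 < s"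
    and bound: "AE t in lebesgue. cmod (g t) \<le> D * (1 + \<bar>t - a\<bar>) powr (- 2 * s)"
  shows "g \<in> L2"
proof -
  note [measurable] = g
  have "(\<integral>\<^sup>+t. ennreal (norm ((cmod (g t))\<^sup>2)) \<partial>lebesgue)
      \<le> (\<integral>\<^sup>+t. ennreal (D\<^sup>2) * ennreal ((1 + \<bar>t - a\<bar>) powr (- s)) \<partial>lebesgue)"
  proof (rule nn_integral_mono_AE, use bound in eventually_elim)
    case (elim t)
    have "(cmod (g t))\<^sup>2 \<le> (D * (1 + \<bar>t - a\<bar>) powr (- 2 * s))\<^sup>2"
      using elim by (intro power_mono) auto
    also have "\<dots> = D\<^sup>2 * (1 + \<bar>t - a\<bar>) powr (- 4 * s)"
      by (simp add: power_mult_distrib power2_eq_square flip: powr_add)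
    also have "\<dots> \<le> D\<^sup>2 * (1 + \<bar>t - a\<bar>) powr (- s)"
      using s by (intro mult_left_mono powr_mono) auto
    finally show ?case by (simp add: ennreal_mult[symmetric] ennreal_leI)
  qed
  also have "\<dots> = ennreal (D\<^sup>2) * (\<integral>\<^sup>+t. ennreal ((1 + \<bar>t - a\<bar>) powr (- s)) \<partial>lebesgue)"
    by (rule nn_integral_cmult) measurable
  also have "\<dots> < \<infinity>" using nn_integral_decay_finite[OF s] by (simp add: ennreal_mult_less_top)
  finally show ?thesis using g unfolding L2_def by (auto intro!: integrableI_bounded)
qed

lemma modulation_eq: "modulation (b * of_int l) g t = fourier_mode l (b * t) * g t"
  by (simp add: modulation_def fourier_mode_def cis_conv_exp mult_ac)

lemma modulation_L2:
  assumes "g \<in> L2" "b \<noteq> 0"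
  shows "modulation (b * of_int l) g \<in> L2"
proof -
  have "(\<lambda>t. fourier_mode l (0 + b * t)) \<in> borel_measurable lebesgue"
    by (rule measurable_lebesgue_affine) (use assms in auto)
  then show ?thesis
    using assms by (auto simp: L2_def modulation_eq[abs_def] norm_mult)
qed


lemma nn_integral_count_space_split_zero:
  fixes f :: "int \<Rightarrow> ennreal"
  shows "(\<integral>\<^sup>+m. f m \<partial>count_space UNIV) = f 0 + (\<integral>\<^sup>+m. f m \<partial>count_space (- {0}))"
proof -
  have "(\<integral>\<^sup>+m. f m \<partial>count_space UNIV)
      = (\<integral>\<^sup>+m. f m * indicator {0} m + f m * indicator (- {0}) m \<partial>count_space UNIV)"
    by (intro nn_integral_cong) (auto simp: indicator_def)
  also have "\<dots> = (\<integral>\<^sup>+m. f m \<partial>count_space {0}) + (\<integral>\<^sup>+m. f m \<partial>count_space (- {0}))"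
    by (simp add: nn_integral_add nn_integral_count_space_indicator)
  finally show ?thesis by (simp add: nn_integral_count_space_finite)
qed

text \<open>The shifted products are estimated by AM-GM in \<open>f\<close> and by the decay of \<open>g\<close>, half of which
  pays for summability over the shifts \<open>m\<close> and half for summability over the centres \<open>a\<close>.\<close>

lemma off_diagonal_term_le:
  fixes f g :: "real \<Rightarrow> complex" and m :: int
  assumes f: "f \<in> borel_measurable lebesgue" and g: "g \<in> borel_measurable lebesgue" and s: "1 < s"
    and b: "0 < b" "b \<le> 1" and D: "0 \<le> D" and m: "m \<noteq> 0"
    and bound: "AE t in lebesgue. cmod (g t) \<le> D * (1 + \<bar>t - a\<bar>) powr (- 2 * s)"
  shows "ennreal (1 / b) * (\<integral>\<^sup>+t. ennreal (cmod (f t * cnj (g t)) * cmod (f (t + of_int m / b) * cnj (g (t + of_int m / b)))) \<partial>lebesgue)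
    \<le> ennreal (D\<^sup>2) * ennreal (\<bar>real_of_int m\<bar> powr (- s))
      * (\<integral>\<^sup>+t. ennreal ((cmod (f t))\<^sup>2) * ennreal ((1 + \<bar>t - a\<bar>) powr (- s)) \<partial>lebesgue)"
proof -
  note [measurable] = f g
  define d where "d = of_int m / b"
  have d: "\<bar>real_of_int m\<bar> / b = \<bar>d\<bar>" using b by (simp add: d_def abs_divide)
  have m0: "0 < \<bar>real_of_int m\<bar>" using m by simp
  have [measurable]: "(\<lambda>t. f (t + d)) \<in> borel_measurable lebesgue" "(\<lambda>t. g (t + d)) \<in> borel_measurable lebesgue"
    by (auto intro: measurable_lebesgue_translate f g)
  define W where "W t = (cmod (f t))\<^sup>2 * (1 + \<bar>t - a\<bar>) powr (- s)" for t
  have W [measurable]: "W \<in> borel_measurable lebesgue" unfolding W_def by measurable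
  have [measurable]: "(\<lambda>t. W (t + d)) \<in> borel_measurable lebesgue" by (rule measurable_lebesgue_translate) measurable
  define c where "c = D\<^sup>2 * \<bar>real_of_int m\<bar> powr (- s)"
  have c: "0 \<le> c" by (simp add: c_def)
  have W0: "0 \<le> W t" for t by (simp add: W_def)
  let ?B = "\<lambda>t. cmod (f t * cnj (g t)) * cmod (f (t + d) * cnj (g (t + d)))"
  have "ennreal (1 / b) * (\<integral>\<^sup>+t. ennreal (?B t) \<partial>lebesgue) = (\<integral>\<^sup>+t. ennreal (1 / b * ?B t) \<partial>lebesgue)"
    using b by (simp add: nn_integral_cmult[symmetric] ennreal_mult[symmetric])
  also have "\<dots> \<le> (\<integral>\<^sup>+t. ennreal (c / 2) * (ennreal (W t) + ennreal (W (t + d))) \<partial>lebesgue)"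
  proof (rule nn_integral_mono_AE, use bound AE_lebesgue_translate[OF bound, of d] in eventually_elim)
    case (elim t)
    define u where "u = 1 + \<bar>t - a\<bar>"
    define v where "v = 1 + \<bar>t + d - a\<bar>"
    have uv: "1 \<le> u" "1 \<le> v" by (auto simp: u_def v_def)
    \<comment> \<open>The triangle inequality through the centre \<open>a\<close>, followed by (u -
      1) (v - 1) \<ge> 0.\<close>
    have "\<bar>d\<bar> + 1 \<le> u + v - 1" by (simp add: u_def v_def)
    also have "\<dots> \<le> u * v" using mult_nonneg_nonneg[of "u - 1" "v - 1"] uv by (simp add: algebra_simps)
    finally have duv: "\<bar>real_of_int m\<bar> / b \<le> u * v" unfolding d by simp
    have k1: "1 / b * (u powr (- 2 * s) * v powr (- 2 * s)) \<le> \<bar>real_of_int m\<bar> powr (- s) * u powr (- s)"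
      by (rule decay_product_le[OF uv m0 b s duv])
    \<comment> \<open>The symmetric variant: the square of f at t is paired with the weight at t,
      the square at t + d with the weight at t + d. The second product is then a translate of the
      first and has the same integral.\<close>
    have k2: "1 / b * (u powr (- 2 * s) * v powr (- 2 * s)) \<le> \<bar>real_of_int m\<bar> powr (- s) * v powr (- s)"
      using decay_product_le[OF uv(2,1) m0 b s] duv by (simp add: mult.commute)
    define \<kappa> where "\<kappa> = 1 / b * (u powr (- 2 * s) * v powr (- 2 * s))"
    have \<kappa>: "0 \<le> \<kappa>" using b by (simp add: \<kappa>_def)
    define x where "x = cmod (f t)"
    define y where "y = cmod (f (t + d))"
    have xy: "x * y \<le> (x\<^sup>2 + y\<^sup>2) / 2" using sum_squares_bound[of x y] by simp
    have xy0: "0 \<le> x" "0 \<le> y" by (auto simp: x_def y_def)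
    have "1 / b * ?B t = (x * y) * (1 / b * (cmod (g t) * cmod (g (t + d))))"
      by (simp add: norm_mult x_def y_def mult_ac)
    also have "\<dots> \<le> (x * y) * (1 / b * ((D * u powr (- 2 * s)) * (D * v powr (- 2 * s))))"
      using elim b D xy0 unfolding u_def v_def by (intro mult_left_mono mult_mono) auto
    also have "\<dots> = D\<^sup>2 * ((x * y) * \<kappa>)" by (simp add: \<kappa>_def power2_eq_square mult_ac)
    also have "\<dots> \<le> D\<^sup>2 * ((x\<^sup>2 + y\<^sup>2) / 2 * \<kappa>)"
      using xy \<kappa> by (intro mult_left_mono mult_right_mono) auto
    also have "\<dots> = D\<^sup>2 / 2 * (x\<^sup>2 * \<kappa> + y\<^sup>2 * \<kappa>)" by (simp add: field_simps)
    also have "\<dots> \<le> D\<^sup>2 / 2 * (x\<^sup>2 * (\<bar>real_of_int m\<bar> powr (- s) * u powr (- s)) + y\<^sup>2 * (\<bar>real_of_int m\<bar> powr (- s) * v powr (- s)))"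
      unfolding \<kappa>_def by (intro mult_left_mono add_mono k1 k2) auto
    also have "\<dots> = c / 2 * (W t + W (t + d))"
      by (simp add: c_def W_def x_def y_def u_def v_def algebra_simps)
    finally show ?case
      using W0 c by (simp add: ennreal_mult[symmetric] ennreal_plus[symmetric] ennreal_leI del: ennreal_plus)
  qed
  also have "\<dots> = ennreal (c / 2) * ((\<integral>\<^sup>+t. ennreal (W t) \<partial>lebesgue) + (\<integral>\<^sup>+t. ennreal (W (t + d)) \<partial>lebesgue))"
    by (simp add: nn_integral_cmult nn_integral_add)
  also have "(\<integral>\<^sup>+t. ennreal (W (t + d)) \<partial>lebesgue) = (\<integral>\<^sup>+t. ennreal (W t) \<partial>lebesgue)"
    by (rule nn_integral_lebesgue_translate[of "\<lambda>t. ennreal (W t)"]) measurable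
  also have "ennreal (c / 2) * ((\<integral>\<^sup>+t. ennreal (W t) \<partial>lebesgue) + (\<integral>\<^sup>+t. ennreal (W t) \<partial>lebesgue))
      = (ennreal (c / 2) * ennreal 2) * (\<integral>\<^sup>+t. ennreal (W t) \<partial>lebesgue)"
    by (simp add: mult_2[symmetric] mult.assoc)
  also have "ennreal (c / 2) * ennreal 2 = ennreal c"
    using c by (subst ennreal_mult[symmetric]) auto
  finally show ?thesis
    by (simp add: c_def W_def d_def ennreal_mult)
qed

text \<open>The coefficients of f against the modulations of one window are Fourier coefficients of
  \<open>f * cnj g\<close>, so \<open>walnut\<close> applies. \<open>M\<close> is the lag 0 term,
  and the remainder \<open>R\<close> is free of b.\<close>

lemma gabor_row_bounds:
  fixes f g :: "real \<Rightarrow> complex" and a s D b :: real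
  defines "S \<equiv> (\<integral>\<^sup>+l. ennreal ((cmod (L2_inner f (modulation (b * of_int l) g)))\<^sup>2) \<partial>count_space UNIV)"
    and "M \<equiv> (\<integral>\<^sup>+t. ennreal ((cmod (f t))\<^sup>2) * ennreal ((cmod (g t))\<^sup>2) \<partial>lebesgue)"
    and "R \<equiv> ennreal (D\<^sup>2) * (\<integral>\<^sup>+m. ennreal (\<bar>real_of_int m\<bar> powr (- s)) \<partial>count_space (- {0}))
        * (\<integral>\<^sup>+t. ennreal ((cmod (f t))\<^sup>2) * ennreal ((1 + \<bar>t - a\<bar>) powr (- s)) \<partial>lebesgue)"
  assumes f: "f \<in> L2" and g: "g \<in> borel_measurable lebesgue" and s: "1 < s"
    and b: "0 < b" "b \<le> 1" and D: "0 \<le> D"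
    and bound: "AE t in lebesgue. cmod (g t) \<le> D * (1 + \<bar>t - a\<bar>) powr (- 2 * s)"
  shows "S \<le> ennreal (1 / b) * M + R" (is ?upper)
    and "ennreal (1 / b) * M \<le> S + R" (is ?lower)
proof -
  have gL2: "g \<in> L2" by (rule L2_decay[OF g s bound])
  have fm: "f \<in> borel_measurable lebesgue" using f by (simp add: L2_def)
  note [measurable] = fm g
  define F where "F t = f t * cnj (g t)" for t
  have Fm [measurable]: "F \<in> borel_measurable lebesgue" unfolding F_def by measurable
  have F: "integrable lebesgue F"
  proof (rule Bochner_Integration.integrable_bound[of _ "\<lambda>t. (cmod (f t))\<^sup>2 + (cmod (g t))\<^sup>2"])
    show "integrable lebesgue (\<lambda>t. (cmod (f t))\<^sup>2 + (cmod (g t))\<^sup>2)"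
      using f gL2 by (simp add: L2_def)
    show "AE t in lebesgue. cmod (F t) \<le> norm ((cmod (f t))\<^sup>2 + (cmod (g t))\<^sup>2)"
    proof (rule AE_I2)
      fix t
      have "cmod (F t) \<le> 2 * cmod (f t) * cmod (g t)" by (simp add: F_def norm_mult)
      also have "\<dots> \<le> (cmod (f t))\<^sup>2 + (cmod (g t))\<^sup>2" by (rule sum_squares_bound)
      finally show "cmod (F t) \<le> norm ((cmod (f t))\<^sup>2 + (cmod (g t))\<^sup>2)" by simp
    qed
  qed measurable
  define A where "A m = (\<integral>\<^sup>+t. ennreal (cmod (F t) * cmod (F (t + of_int m / b))) \<partial>lebesgue)" for m :: int
  define I where "I = (\<integral>\<^sup>+t. ennreal ((cmod (f t))\<^sup>2) * ennreal ((1 + \<bar>t - a\<bar>) powr (- s)) \<partial>lebesgue)"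
  have F2: "ennreal ((cmod (F t))\<^sup>2) = ennreal ((cmod (f t))\<^sup>2) * ennreal ((cmod (g t))\<^sup>2)" for t
    by (simp add: F_def norm_mult power_mult_distrib ennreal_mult)
  have A0: "A 0 = M" unfolding A_def M_def F2[symmetric] by (simp add: power2_eq_square)
  have off: "ennreal (1 / b) * (\<integral>\<^sup>+m. A m \<partial>count_space (- {0})) \<le> R"
  proof -
    have "ennreal (1 / b) * (\<integral>\<^sup>+m. A m \<partial>count_space (- {0})) = (\<integral>\<^sup>+m. ennreal (1 / b) * A m \<partial>count_space (- {0}))"
      by (simp add: nn_integral_cmult)
    also have "\<dots> \<le> (\<integral>\<^sup>+m. ennreal (D\<^sup>2) * ennreal (\<bar>real_of_int m\<bar> powr (- s)) * I \<partial>count_space (- {0}))"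
      unfolding A_def F_def I_def
      by (intro nn_integral_mono off_diagonal_term_le fm g s b D bound) simp
    also have "\<dots> = R" by (simp add: R_def I_def nn_integral_cmult nn_integral_multc)
    finally show ?thesis .
  qed
  \<comment> \<open>\<open>walnut\<close> presupposes finite correlations. These follow from the
    bounds just obtained, as the window and the weight are bounded and f is
    square-integrable.\<close>
  have f_fin: "(\<integral>\<^sup>+t. ennreal ((cmod (f t))\<^sup>2) \<partial>lebesgue) < \<infinity>"
    using L2_nn_integral[OF f] by simp
  have decay_le_1: "(1 + \<bar>t - a\<bar>) powr (- r) \<le> 1" if "0 < r" for t r :: real
    using that powr_mono[of "- r" 0 "1 + \<bar>t - a\<bar>"] by (auto split: if_splits)
  have I_fin: "I < \<infinity>"
  proof -
    have "I \<le> (\<integral>\<^sup>+t. ennreal ((cmod (f t))\<^sup>2) * 1 \<partial>lebesgue)"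
      unfolding I_def using decay_le_1 s by (intro nn_integral_mono mult_left_mono) auto
    then show ?thesis using f_fin by simp
  qed
  have M_fin: "M < \<infinity>"
  proof -
    have "M \<le> (\<integral>\<^sup>+t. ennreal ((cmod (f t))\<^sup>2) * ennreal (D\<^sup>2) \<partial>lebesgue)"
      unfolding M_def
    proof (rule nn_integral_mono_AE, use bound in eventually_elim)
      case (elim t)
      have "cmod (g t) \<le> D * 1"
        using elim decay_le_1[of "2 * s" t] s D mult_left_mono[of "(1 + \<bar>t - a\<bar>) powr (- 2 * s)" 1 D]
        by simp
      then show ?case by (intro mult_left_mono ennreal_leI power_mono) auto
    qed
    also have "\<dots> = (\<integral>\<^sup>+t. ennreal ((cmod (f t))\<^sup>2) \<partial>lebesgue) * ennreal (D\<^sup>2)"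
      by (rule nn_integral_multc) measurable
    finally show ?thesis using f_fin by (auto simp: ennreal_mult_less_top intro: le_less_trans)
  qed
  have R_fin: "R < \<infinity>"
    using I_fin punctured_decay_sum_finite[OF s] unfolding R_def I_def[symmetric]
    by (auto simp: ennreal_mult_less_top)
  have off_fin: "(\<integral>\<^sup>+m. A m \<partial>count_space (- {0})) < \<infinity>"
    using le_less_trans[OF off R_fin] b by (auto simp: ennreal_mult_less_top)
  have fin: "(\<integral>\<^sup>+m. A m \<partial>count_space UNIV) < \<infinity>"
    using off_fin M_fin by (simp add: nn_integral_count_space_split_zero A0)
  have inner: "L2_inner f (modulation (b * of_int l) g) = (LINT t|lebesgue. F t * cnj (fourier_mode l (b * t)))" for l
    by (simp add: L2_inner_def modulation_eq F_def mult_ac)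
  note w = walnut[OF F b(1) fin[unfolded A_def], folded A_def inner, folded S_def]
  have "S \<le> ennreal (1 / b) * (M + (\<integral>\<^sup>+m. A m \<partial>count_space (- {0})))"
    using w(1) by (simp add: nn_integral_count_space_split_zero A0)
  also have "\<dots> \<le> ennreal (1 / b) * M + R"
    using off by (simp add: distrib_left add_left_mono)
  finally show ?upper .
  have "ennreal (1 / b) * M \<le> S + ennreal (1 / b) * (\<integral>\<^sup>+m. A m \<partial>count_space (- {0}))"
    using w(2) by (simp add: F2 M_def)
  also have "\<dots> \<le> S + R" using off by (rule add_left_mono)
  finally show ?lower .
qed

section \<open>The frame property\<close>

theorem theorem3p4:
  fixes p\<^sub>L p\<^sub>U C\<^sub>L C\<^sub>U \<delta> A\<^sub>0 B\<^sub>0 :: real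
    and a p C :: "int \<Rightarrow> real"
    and g :: "int \<Rightarrow> real \<Rightarrow> complex"
  assumes "2 < p\<^sub>L" and "p\<^sub>L \<le> p\<^sub>U"
    and "0 < C\<^sub>L" and "C\<^sub>L \<le> C\<^sub>U"
    and "0 < \<delta>" and "separated \<delta> a"
    and "\<And>k. g k \<in> wiener_space"
    and "0 < A\<^sub>0" and "0 < B\<^sub>0"
    and "AE t in lebesgue.
           ennreal A\<^sub>0 \<le> (\<Sum>\<^sub>\<infinity>k\<in>UNIV. ennreal ((cmod (g k t))\<^sup>2)) \<and>
           (\<Sum>\<^sub>\<infinity>k\<in>UNIV. ennreal ((cmod (g k t))\<^sup>2)) \<le> ennreal B\<^sub>0"
    and "\<And>k. p k \<in> {p\<^sub>L..p\<^sub>U}" and "\<And>k. C k \<in> {C\<^sub>L..C\<^sub>U}"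
    and "\<And>k. AE t in lebesgue. cmod (g k t) \<le> C k * (1 + \<bar>t - a k\<bar>) powr (- p k)"
  shows "\<exists>b\<^sub>0 :: int \<Rightarrow> real.
           (\<forall>k. 0 < b\<^sub>0 k) \<and> 0 < (INF k. b\<^sub>0 k) \<and>
           (\<forall>b :: int \<Rightarrow> real.
              (\<exists>b\<^sub>L b\<^sub>U. 0 < b\<^sub>L \<and> b\<^sub>L \<le> b\<^sub>U \<and> (\<forall>k. b k \<in> {b\<^sub>L..b\<^sub>U})) \<and> (\<forall>k. b k \<le> b\<^sub>0 k) \<longrightarrow>
              L2_frame (nonstationary_gabor_system g b))"
proof -
  let ?c = "count_space (UNIV :: int set)"
  define s where "s = p\<^sub>L / 2"
  have s: "1 < s" using assms(1) by (simp add: s_def)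
  have D: "0 \<le> C\<^sub>U" using assms(3,4) by simp
  have gm [measurable]: "g k \<in> borel_measurable lebesgue" for k
    using assms(7)[of k] by (simp add: wiener_space_def Linf_def)
  \<comment> \<open>The base of the power is at least 1, so the smallest exponent
    \<open>p\<^sub>L\<close> = 2s and the largest constant \<open>C\<^sub>U\<close> serve all
    windows at once.\<close>
  have bound: "AE t in lebesgue. cmod (g k t) \<le> C\<^sub>U * (1 + \<bar>t - a k\<bar>) powr (- 2 * s)" for k
  proof (use assms(13)[of k] in eventually_elim)
    case (elim t)
    also have "C k * (1 + \<bar>t - a k\<bar>) powr (- p k) \<le> C\<^sub>U * (1 + \<bar>t - a k\<bar>) powr (- 2 * s)"
      using assms(11)[of k] assms(12)[of k] D by (intro mult_mono powr_mono) (auto simp: s_def)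
    finally show ?case .
  qed
  define Z where "Z = (\<integral>\<^sup>+m. ennreal (\<bar>real_of_int m\<bar> powr (- s)) \<partial>count_space (- {0}))"
  define W where "W = ennreal ((min 1 \<delta> / 2) powr (- s)) * decay_sum s"
  have "Z < \<infinity>" "W < \<infinity>"
    using punctured_decay_sum_finite[OF s] decay_sum_finite[OF s]
    by (auto simp: Z_def W_def ennreal_mult_less_top)
  then have "ennreal (C\<^sub>U\<^sup>2) * Z * W < \<infinity>" by (simp add: ennreal_mult_less_top)
  \<comment> \<open>The constant collects two window factors in \<open>C\<^sub>U\<^sup>2\<close>,
    the sum over shifts \<open>Z\<close> and the sum over centres \<open>W\<close>; none of them
    involves b.\<close>
  then obtain K where K: "0 \<le> K" "ennreal (C\<^sub>U\<^sup>2) * Z * W = ennreal K"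
    by (cases "ennreal (C\<^sub>U\<^sup>2) * Z * W") auto
  \<comment> \<open>The 1 in the minimum ensures b \<le> 1, as the row estimate requires. The
    denominator K + 1 makes the diagonal at least (K + 1) times the squared norm, one more than the
    error can consume.\<close>
  define \<beta> where "\<beta> = min 1 (A\<^sub>0 / (K + 1))"
  have \<beta>: "0 < \<beta>" "\<beta> \<le> 1" "\<beta> \<le> A\<^sub>0 / (K + 1)" using K assms(8) by (auto simp: \<beta>_def)
  have frame: "L2_frame (nonstationary_gabor_system g b)"
    if bLU: "0 < b\<^sub>L" "b\<^sub>L \<le> b\<^sub>U" "\<And>k. b k \<in> {b\<^sub>L..b\<^sub>U}" and b\<beta>: "\<And>k. b k \<le> \<beta>" for b b\<^sub>L b\<^sub>U
  proof -
    have bk: "0 < b k" "b k \<le> 1" "b\<^sub>L \<le> b k" "b k \<le> A\<^sub>0 / (K + 1)" for k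
      using bLU(1) bLU(3)[of k] b\<beta>[of k] \<beta> by auto
    have inL2: "nonstationary_gabor_system g b i \<in> L2" for i
    proof -
      have "g (fst i) \<in> L2" by (rule L2_decay[OF gm s bound])
      then show ?thesis
        using bk(1)[of "fst i"] by (auto simp: nonstationary_gabor_system_def split_def intro!: modulation_L2)
    qed
    \<comment> \<open>\<open>B\<^sub>0 / b\<^sub>L\<close> bounds the diagonal and K the error; the
      extra 1 guarantees that the upper bound is not below the lower bound 1.\<close>
    define B where "B = B\<^sub>0 / b\<^sub>L + K + 1"
    have B: "1 \<le> B" using assms(9) bLU(1) K(1) by (simp add: B_def)
    have bounds: "ennreal (1 * (L2_norm f)\<^sup>2)
        \<le> (\<Sum>\<^sub>\<infinity>i\<in>UNIV. ennreal ((cmod (L2_inner f (nonstationary_gabor_system g b i)))\<^sup>2)) \<and>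
      (\<Sum>\<^sub>\<infinity>i\<in>UNIV. ennreal ((cmod (L2_inner f (nonstationary_gabor_system g b i)))\<^sup>2))
        \<le> ennreal (B * (L2_norm f)\<^sup>2)" if f: "f \<in> L2" for f
    proof -
      have fm [measurable]: "f \<in> borel_measurable lebesgue" using f by (simp add: L2_def)
      define r where "r = (L2_norm f)\<^sup>2"
      have r: "0 \<le> r" "(\<integral>\<^sup>+t. ennreal ((cmod (f t))\<^sup>2) \<partial>lebesgue) = ennreal r"
        using L2_nn_integral[OF f] by (auto simp: r_def)
      define T where "T = (\<Sum>\<^sub>\<infinity>i\<in>UNIV. ennreal ((cmod (L2_inner f (nonstationary_gabor_system g b i)))\<^sup>2))"
      define S where "S k = (\<integral>\<^sup>+l. ennreal ((cmod (L2_inner f (modulation (b k * of_int l) (g k))))\<^sup>2) \<partial>?c)" for k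
      define M where "M k = (\<integral>\<^sup>+t. ennreal ((cmod (f t))\<^sup>2) * ennreal ((cmod (g k t))\<^sup>2) \<partial>lebesgue)" for k
      define I where "I k = (\<integral>\<^sup>+t. ennreal ((cmod (f t))\<^sup>2) * ennreal ((1 + \<bar>t - a k\<bar>) powr (- s)) \<partial>lebesgue)" for k
      have row: "S k \<le> ennreal (1 / b k) * M k + ennreal (C\<^sub>U\<^sup>2) * Z * I k"
        "ennreal (1 / b k) * M k \<le> S k + ennreal (C\<^sub>U\<^sup>2) * Z * I k" for k
        unfolding Z_def S_def M_def I_def
        by (rule gabor_row_bounds[OF f gm s bk(1,2) D bound])+
      have T: "T = (\<integral>\<^sup>+k. S k \<partial>?c)"
      proof -
        have "infinite (UNIV :: (int \<times> int) set)" by (simp add: finite_prod)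
        then show ?thesis
          unfolding T_def S_def
          by (subst infsum_eq_nn_integral_count_space)
            (simp_all add: nonstationary_gabor_system_def flip: nn_integral_fst_count_space)
      qed
      \<comment> \<open>Interchanging sum and integral turns the diagonal into f weighted by the sum
        of the squared windows, which hypothesis (i) controls on both sides.\<close>
      have sumM: "(\<integral>\<^sup>+k. M k \<partial>?c) = (\<integral>\<^sup>+t. ennreal ((cmod (f t))\<^sup>2) * (\<Sum>\<^sub>\<infinity>k\<in>UNIV. ennreal ((cmod (g k t))\<^sup>2)) \<partial>lebesgue)"
        unfolding M_def infsum_eq_nn_integral_count_space[OF infinite_UNIV_int]
        by (subst nn_integral_count_space_nn_integral[symmetric]) (auto simp: nn_integral_cmult)
      have M_lower: "ennreal A\<^sub>0 * ennreal r \<le> (\<integral>\<^sup>+k. M k \<partial>?c)"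
      proof -
        have "ennreal A\<^sub>0 * ennreal r = (\<integral>\<^sup>+t. ennreal ((cmod (f t))\<^sup>2) * ennreal A\<^sub>0 \<partial>lebesgue)"
          by (subst nn_integral_multc) (simp_all add: r mult.commute)
        also have "\<dots> \<le> (\<integral>\<^sup>+k. M k \<partial>?c)"
          unfolding sumM
          by (rule nn_integral_mono_AE, use assms(10) in eventually_elim) (auto intro: mult_left_mono)
        finally show ?thesis .
      qed
      have M_upper: "(\<integral>\<^sup>+k. M k \<partial>?c) \<le> ennreal B\<^sub>0 * ennreal r"
      proof -
        have "(\<integral>\<^sup>+k. M k \<partial>?c) \<le> (\<integral>\<^sup>+t. ennreal ((cmod (f t))\<^sup>2) * ennreal B\<^sub>0 \<partial>lebesgue)"
          unfolding sumM
          by (rule nn_integral_mono_AE, use assms(10) in eventually_elim) (auto intro: mult_left_mono)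
        also have "\<dots> = ennreal B\<^sub>0 * ennreal r"
          by (subst nn_integral_multc) (simp_all add: r mult.commute)
        finally show ?thesis .
      qed
      have R: "(\<integral>\<^sup>+k. ennreal (C\<^sub>U\<^sup>2) * Z * I k \<partial>?c) \<le> ennreal K * ennreal r"
      proof -
        have "(\<integral>\<^sup>+k. I k \<partial>?c) = (\<integral>\<^sup>+t. ennreal ((cmod (f t))\<^sup>2) * (\<integral>\<^sup>+k. ennreal ((1 + \<bar>t - a k\<bar>) powr (- s)) \<partial>?c) \<partial>lebesgue)"
          unfolding I_def
          by (subst nn_integral_count_space_nn_integral[symmetric]) (auto simp: nn_integral_cmult)
        also have "\<dots> \<le> (\<integral>\<^sup>+t. ennreal ((cmod (f t))\<^sup>2) * W \<partial>lebesgue)"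
          unfolding W_def
          by (intro nn_integral_mono mult_left_mono separated_decay_sum_le assms(5,6) s) simp
        also have "\<dots> = W * ennreal r" by (subst nn_integral_multc) (simp_all add: r mult.commute)
        finally have I_le: "(\<integral>\<^sup>+k. I k \<partial>?c) \<le> W * ennreal r" .
        have "(\<integral>\<^sup>+k. ennreal (C\<^sub>U\<^sup>2) * Z * I k \<partial>?c) = ennreal (C\<^sub>U\<^sup>2) * Z * (\<integral>\<^sup>+k. I k \<partial>?c)"
          by (simp add: nn_integral_cmult)
        also have "\<dots> \<le> ennreal (C\<^sub>U\<^sup>2) * Z * (W * ennreal r)"
          using I_le by (rule mult_left_mono) simp
        finally show ?thesis by (simp add: K(2)[symmetric] mult.assoc)
      qed
      have "T \<le> (\<integral>\<^sup>+k. ennreal (1 / b\<^sub>L) * M k + ennreal (C\<^sub>U\<^sup>2) * Z * I k \<partial>?c)"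
        unfolding T
      proof (rule nn_integral_mono)
        fix k
        have "ennreal (1 / b k) \<le> ennreal (1 / b\<^sub>L)"
          using bk[of k] bLU(1) by (intro ennreal_leI divide_left_mono) auto
        then have "ennreal (1 / b k) * M k \<le> ennreal (1 / b\<^sub>L) * M k" by (rule mult_right_mono) simp
        then show "S k \<le> ennreal (1 / b\<^sub>L) * M k + ennreal (C\<^sub>U\<^sup>2) * Z * I k"
          using row(1)[of k] by (elim order_trans) (rule add_right_mono)
      qed
      also have "\<dots> = ennreal (1 / b\<^sub>L) * (\<integral>\<^sup>+k. M k \<partial>?c) + (\<integral>\<^sup>+k. ennreal (C\<^sub>U\<^sup>2) * Z * I k \<partial>?c)"
        by (simp add: nn_integral_add nn_integral_cmult)
      also have "\<dots> \<le> ennreal (1 / b\<^sub>L) * (ennreal B\<^sub>0 * ennreal r) + ennreal K * ennreal r"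
        by (intro add_mono mult_left_mono M_upper R) simp
      also have "\<dots> = ennreal (1 / b\<^sub>L * (B\<^sub>0 * r) + K * r)"
        using bLU(1) assms(9) r(1) K(1) by (simp add: ennreal_mult[symmetric] ennreal_plus[symmetric] del: ennreal_plus)
      also have "\<dots> \<le> ennreal (B * r)"
        using r(1) by (intro ennreal_leI) (simp add: B_def algebra_simps)
      finally have upper: "T \<le> ennreal (B * r)" .
      \<comment> \<open>The weights 1/b vary with k; replacing them by their common lower bound (K +
        1) / \<open>A\<^sub>0\<close> makes the bound on the summed diagonal applicable.\<close>
      have "ennreal ((K + 1) / A\<^sub>0) * (ennreal A\<^sub>0 * ennreal r) \<le> ennreal ((K + 1) / A\<^sub>0) * (\<integral>\<^sup>+k. M k \<partial>?c)"
        using M_lower by (rule mult_left_mono) simp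
      also have "\<dots> = (\<integral>\<^sup>+k. ennreal ((K + 1) / A\<^sub>0) * M k \<partial>?c)"
        by (simp add: nn_integral_cmult)
      also have "\<dots> \<le> (\<integral>\<^sup>+k. S k + ennreal (C\<^sub>U\<^sup>2) * Z * I k \<partial>?c)"
      proof (rule nn_integral_mono)
        fix k
        have "ennreal ((K + 1) / A\<^sub>0) \<le> ennreal (1 / b k)"
          using bk[of k] K(1) assms(8) by (intro ennreal_leI) (simp add: field_simps)
        then have "ennreal ((K + 1) / A\<^sub>0) * M k \<le> ennreal (1 / b k) * M k" by (rule mult_right_mono) simp
        then show "ennreal ((K + 1) / A\<^sub>0) * M k \<le> S k + ennreal (C\<^sub>U\<^sup>2) * Z * I k"
          using row(2)[of k] by (rule order_trans)
      qed
      also have "\<dots> = T + (\<integral>\<^sup>+k. ennreal (C\<^sub>U\<^sup>2) * Z * I k \<partial>?c)"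
        unfolding T by (simp add: nn_integral_add)
      also have "\<dots> \<le> T + ennreal K * ennreal r" using R by (rule add_left_mono)
      also have "ennreal ((K + 1) / A\<^sub>0) * (ennreal A\<^sub>0 * ennreal r) = ennreal r + ennreal (K * r)"
        using K(1) r(1) assms(8)
        by (simp add: ennreal_mult[symmetric] ennreal_plus[symmetric] field_simps del: ennreal_plus)
      \<comment> \<open>The error is cancelled rather than subtracted, which is valid because K r is
        finite.\<close>
      finally have "ennreal (K * r) + ennreal r \<le> ennreal (K * r) + T"
        using K(1) r(1) by (simp add: ennreal_mult add.commute)
      then have "ennreal r \<le> T" by (simp add: ennreal_add_left_cancel_le)
      with upper show ?thesis unfolding T_def[symmetric] r_def[symmetric] by simp
    qed
    show ?thesis
      unfolding L2_frame_def using inL2 bounds B by (intro conjI allI exI[of _ 1] exI[of _ B] ballI) auto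
  qed
  show ?thesis
  proof (intro exI[of _ "\<lambda>_. \<beta>"] conjI allI impI)
    fix b :: "int \<Rightarrow> real"
    assume "(\<exists>b\<^sub>L b\<^sub>U. 0 < b\<^sub>L \<and> b\<^sub>L \<le> b\<^sub>U \<and> (\<forall>k. b k \<in> {b\<^sub>L..b\<^sub>U})) \<and> (\<forall>k. b k \<le> \<beta>)"
    then show "L2_frame (nonstationary_gabor_system g b)"
      using frame by blast
  qed (use \<beta> in auto)
qed

end
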